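(* Let $(\overline{u_\delta},\overline{g_\delta})$ solve the nonlocal continuous problem: minimize $I(u,g)$ over $(u,g)\in X_0(\Omega_\delta;\mathbb{R}^n)\times Z_{\mathrm{ad}}$ with $B_\delta(u,v)=\langle g,v\rangle$ for all $v\in X_0(\Omega_\delta;\mathbb{R}^n)$; and let $\overline{p_\delta}\in X_0(\Omega_\delta;\mathbb{R}^n)$ be the adjoint, $B_\delta(v,\overline{p_\delta})=\langle\overline{u_\delta},v\rangle$ for all $v\in X_0(\Omega_\delta;\mathbb{R}^n)$. Let $(\overline{u_{\delta,h}},\overline{g_{\delta,h}})$ solve the nonlocal discrete problem: minimize $I(u,g)$ over $(u,g)\in X_{\delta,h}\times(Z_{\mathrm{ad}}\cap Z_h)$ with $B_\delta(u,v)=\langle g,v\rangle$ for all $v\in X_{\delta,h}$; and let $\overline{p_{\delta,h}}\in X_{\delta,h}$ be the discrete adjoint, $B_\delta(v,\overline{p_{\delta,h}})=\langle\overline{u_{\delta,h}},v\rangle$ for all $v\in X_{\delta,h}$. Let $\widehat{u_\delta},\widehat{p_\delta}\in X_0(\Omega_\delta;\mathbb{R}^n)$ be defined by $B_\delta(\widehat{u_\delta},v)=\langle\overline{g_{\delta,h}},v\rangle$ and $B_\delta(v,\widehat{p_\delta})=\langle v,\overline{u_{\delta,h}}\rangle$ for all $v\in X_0(\Omega_\delta;\mathbb{R}^n)$. Then there are $\delta_0>0$ and a constant $C>0$, independent of $h$ and of $\delta\in(0,\delta_0]$, such that for all $h>0$ and $\delta\in(0,\delta_0]$ $$\|\overline{u_\delta}-\overline{u_{\delta,h}}\|_{X(\Omega_\delta;\mathbb{R}^n)}\le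 C\Big(\inf_{v\in X_{\delta,h}}\|\widehat{u_\delta}-v\|_{X(\Omega_\delta;\mathbb{R}^n)}+\|\overline{g_\delta}-\overline{g_{\delta,h}}\|_{L^2(\Omega;\mathbb{R}^n)}\Big)$$ and $$\|\overline{p_\delta}-\overline{p_{\delta,h}}\|_{X(\Omega_\delta;\mathbb{R}^n)}\le C\Big(\inf_{v\in X_{\delta,h}}\|\widehat{p_\delta}-v\|_{X(\Omega_\delta;\mathbb{R}^n)}+\inf_{v\in X_{\delta,h}}\|\widehat{u_\delta}-v\|_{X(\Omega_\delta;\mathbb{R}^n)}+\|\overline{g_\delta}-\overline{g_{\delta,h}}\|_{L^2(\Omega;\mathbb{R}^n)}\Big).$$
   Context: $\Omega\subset\mathbb{R}^n$ is a bounded open set with Lipschitz boundary; for $\delta>0$, $\Omega_\delta=\Omega\cup\{x\in\mathbb{R}^n:\operatorname{dist}(x,\Omega)<\delta\}$ and $\mathcal{D}_\delta=(\Omega\times\Omega_\delta)\cup(\Omega_\delta\times\Omega)$. Kernels: $\{k_\delta\}_{\delta>0}$ is a family of radial nonnegative functions in $L^1(\mathbb{R}^n)$ (written $k_\delta(\xi)=k_\delta(|\xi|)$), supported in $B_\delta(0)$, with $\int_{\mathbb{R}^n}k_\delta(|\xi|)\,d\xi=1$, $\lim_{\delta\to0^+}\int_{\mathbb{R}^n\setminus B_\epsilon(0)}k_\delta(|\xi|)\,d\xi=0$ for all $\epsilon>0$, and such that for each $\delta$ the function $r\mapsto k_\delta(r)r^{-2}$ is non-increasing. Coefficient: $H(x,y)=\frac12(h(x)+h(y))$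 where $h$ is a measurable function, independent of $\delta$, with $0<h_{\min}\le h(x)\le h_{\max}$ on every $\Omega_\delta$ under consideration (unrelated to the mesh size $h$). Spaces: $Du(x,y)=(u(x)-u(y))\cdot\frac{x-y}{|x-y|}$. $X(\Omega_\delta;\mathbb{R}^n)$ is the space of measurable $u:\Omega_\delta\to\mathbb{R}^n$ with $u|_\Omega\in L^2(\Omega;\mathbb{R}^n)$ and $[u]_{X(\Omega_\delta;\mathbb{R}^n)}^2:=\iint_{\mathcal{D}_\delta}k_\delta(|x-y|)\frac{|Du(x,y)|^2}{|x-y|^2}\,dx\,dy<\infty$, with norm $\|u\|_{X(\Omega_\delta;\mathbb{R}^n)}=(\|u\|_{L^2(\Omega)}^2+[u]_{X(\Omega_\delta;\mathbb{R}^n)}^2)^{1/2}$. $X_0(\Omega_\delta;\mathbb{R}^n)=\{u\in X(\Omega_\delta;\mathbb{R}^n): u=0\text{ on }\Omega_\delta\setminus\Omega\}$. $\langle\cdot,\cdot\rangle$ is the $L^2(\Omega;\mathbb{R}^n)$ inner product. $B_\delta(u,v)=\frac12\iint_{\mathcal{D}_\delta}H(x,y)k_\delta(x-y)\frac{Du(x,y)}{|x-y|}\frac{Dv(x,y)}{|x-y|}\,dx\,dy$. Controls: $Z_{\mathrm{ad}}=\{z\in L^2(\Omega;\mathbb{R}^n): a(x)\preceq z(x)\preceq b(x)\text{ a.e.}\}$ with $a,b\in L^\infty(\Omega;\mathbb{R}^n)$, $\preceq$ componentwise; it is assumed $0\in Z_{\mathrm{ad}}$. Objective: $I(u,g)=\frac12\int_\Omega|u|^2\,dx+\frac{\lambda}{2}\int_\Omega|g|^2\,dx$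 with $\lambda>0$ fixed. Discrete spaces: $\{\mathscr{T}_h\}_{h>0}$ is a quasi-uniform family of meshes of size $h$ discretizing $\Omega_\delta$. $X_{\delta,h}$ is the space of continuous functions $\overline{\Omega_\delta}\to\mathbb{R}^n$ that are affine on each $T\in\mathscr{T}_h$ and vanish on $\Omega_\delta\setminus\Omega$. $Z_h$ is the space of $\mathbb{R}^n$-valued functions constant on each $T\in\mathscr{T}_h$, regarded as functions on $\Omega$ by restriction. *)

theory Defs
  imports "HOL-Analysis.Analysis"
begin

text \<open>
  Functions on a subset of $R^n$ are total functions whose values off that subset are irrelevant.
  Elements of $L^2$, $L^\infty$ and $X$ are represented by Lebesgue measurable functions, and
  conditions on them are imposed almost everywhere.
\<close>

text \<open>
  Near each boundary point the set is the part of a ball lying strictly above the graph of a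
  Lipschitz function over the hyperplane orthogonal to a unit vector \<open>e\<close> (the rotated last
  coordinate axis).
\<close>
definition lipschitz_boundary :: "(real^'n) set \<Rightarrow> bool" where
  "lipschitz_boundary \<Omega> \<longleftrightarrow>
     (\<forall>x0 \<in> frontier \<Omega>. \<exists>r>0. \<exists>e. norm e = 1 \<and> (\<exists>\<gamma> L. L-lipschitz_on {y. y \<bullet> e = 0} \<gamma> \<and>
        \<Omega> \<inter> ball x0 r = {x \<in> ball x0 r. \<gamma> (x - (x \<bullet> e) *\<^sub>R e) < x \<bullet> e}))"

definition Omega_ext :: "(real^'n) set \<Rightarrow> real \<Rightarrow> (real^'n) set" where
  "Omega_ext \<Omega> \<delta> = \<Omega> \<union> {x. infdist x \<Omega> < \<delta>}"

definition D_dom :: "(real^'n) set \<Rightarrow> real \<Rightarrow> ((real^'n) \<times> (real^'n)) set" where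
  "D_dom \<Omega> \<delta> = (\<Omega> \<times> Omega_ext \<Omega> \<delta>) \<union> (Omega_ext \<Omega> \<delta> \<times> \<Omega>)"

text \<open>
  \<open>k \<delta>\<close> is the radial profile: the kernel on $R^n$ is \<open>\<lambda>\<xi>. k \<delta> (norm \<xi>)\<close>. The type argument
  only fixes the dimension of the space on which the profile is integrated.
\<close>
definition kernel_family :: "'n::finite itself \<Rightarrow> (real \<Rightarrow> real \<Rightarrow> real) \<Rightarrow> bool" where
  "kernel_family _ k \<longleftrightarrow>
     (\<forall>\<delta>>0.
        (\<forall>r\<ge>0. 0 \<le> k \<delta> r) \<and>
        integrable lebesgue (\<lambda>\<xi>::real^'n. k \<delta> (norm \<xi>)) \<and>
        (\<forall>\<xi>::real^'n. \<xi> \<notin> ball 0 \<delta> \<longrightarrow> k \<delta> (norm \<xi>) = 0) \<and>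
        (LINT \<xi>::real^'n|lebesgue. k \<delta> (norm \<xi>)) = 1 \<and>
        (\<forall>r s. 0 < r \<longrightarrow> r \<le> s \<longrightarrow> k \<delta> s / s\<^sup>2 \<le> k \<delta> r / r\<^sup>2)) \<and>
     (\<forall>\<epsilon>>0. ((\<lambda>\<delta>. LINT \<xi>::real^'n|lebesgue_on (- ball 0 \<epsilon>). k \<delta> (norm \<xi>)) \<longlongrightarrow> 0) (at_right 0))"

definition L2 :: "(real^'n) set \<Rightarrow> (real^'n \<Rightarrow> real^'n) set" where
  "L2 \<Omega> = {u. u \<in> borel_measurable (lebesgue_on \<Omega>) \<and>
              integrable (lebesgue_on \<Omega>) (\<lambda>x. (norm (u x))\<^sup>2)}"

definition L2_inner :: "(real^'n) set \<Rightarrow> (real^'n \<Rightarrow> real^'n) \<Rightarrow> (real^'n \<Rightarrow> real^'n) \<Rightarrow> real" where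
  "L2_inner \<Omega> u v = (LINT x|lebesgue_on \<Omega>. u x \<bullet> v x)"

definition L2_norm :: "(real^'n) set \<Rightarrow> (real^'n \<Rightarrow> real^'n) \<Rightarrow> real" where
  "L2_norm \<Omega> u = sqrt (LINT x|lebesgue_on \<Omega>. (norm (u x))\<^sup>2)"

definition Linfty :: "(real^'n) set \<Rightarrow> (real^'n \<Rightarrow> real^'n) set" where
  "Linfty \<Omega> = {a. a \<in> borel_measurable (lebesgue_on \<Omega>) \<and>
                  (\<exists>M. AE x in lebesgue_on \<Omega>. norm (a x) \<le> M)}"

definition Dop :: "(real^'n \<Rightarrow> real^'n) \<Rightarrow> real^'n \<Rightarrow> real^'n \<Rightarrow> real" where
  "Dop u x y = (u x - u y) \<bullet> ((x - y) /\<^sub>R norm (x - y))"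

definition X_integrand ::
  "(real \<Rightarrow> real) \<Rightarrow> (real^'n \<Rightarrow> real^'n) \<Rightarrow> (real^'n) \<times> (real^'n) \<Rightarrow> real" where
  "X_integrand k u = (\<lambda>(x, y). k (norm (x - y)) * (\<bar>Dop u x y\<bar>\<^sup>2 / (norm (x - y))\<^sup>2))"

text \<open>The integrand is nonnegative on the domain, so integrability says that the double integral is
  finite.\<close>
definition X_space :: "(real^'n) set \<Rightarrow> (real \<Rightarrow> real) \<Rightarrow> real \<Rightarrow> (real^'n \<Rightarrow> real^'n) set" where
  "X_space \<Omega> k \<delta> = {u. u \<in> borel_measurable (lebesgue_on (Omega_ext \<Omega> \<delta>)) \<and> u \<in> L2 \<Omega> \<and>
                        integrable (lebesgue_on (D_dom \<Omega> \<delta>)) (X_integrand k u)}"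

definition X_seminorm :: "(real^'n) set \<Rightarrow> (real \<Rightarrow> real) \<Rightarrow> real \<Rightarrow> (real^'n \<Rightarrow> real^'n) \<Rightarrow> real" where
  "X_seminorm \<Omega> k \<delta> u = sqrt (LINT z|lebesgue_on (D_dom \<Omega> \<delta>). X_integrand k u z)"

definition X_norm :: "(real^'n) set \<Rightarrow> (real \<Rightarrow> real) \<Rightarrow> real \<Rightarrow> (real^'n \<Rightarrow> real^'n) \<Rightarrow> real" where
  "X_norm \<Omega> k \<delta> u = sqrt ((L2_norm \<Omega> u)\<^sup>2 + (X_seminorm \<Omega> k \<delta> u)\<^sup>2)"

definition X0_space :: "(real^'n) set \<Rightarrow> (real \<Rightarrow> real) \<Rightarrow> real \<Rightarrow> (real^'n \<Rightarrow> real^'n) set" where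
  "X0_space \<Omega> k \<delta> = {u \<in> X_space \<Omega> k \<delta>. AE x in lebesgue_on (Omega_ext \<Omega> \<delta> - \<Omega>). u x = 0}"

definition H_coef :: "(real^'n \<Rightarrow> real) \<Rightarrow> real^'n \<Rightarrow> real^'n \<Rightarrow> real" where
  "H_coef \<kappa> x y = (\<kappa> x + \<kappa> y) / 2"

definition B_form :: "(real^'n) set \<Rightarrow> (real^'n \<Rightarrow> real) \<Rightarrow> (real \<Rightarrow> real) \<Rightarrow> real \<Rightarrow>
    (real^'n \<Rightarrow> real^'n) \<Rightarrow> (real^'n \<Rightarrow> real^'n) \<Rightarrow> real" where
  "B_form \<Omega> \<kappa> k \<delta> u v = 1/2 * (LINT (x, y)|lebesgue_on (D_dom \<Omega> \<delta>).
      H_coef \<kappa> x y * k (norm (x - y)) * (Dop u x y / norm (x - y)) * (Dop v x y / norm (x - y)))"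

text \<open>
  A conforming simplicial mesh of size \<open>h\<close> discretizing the open set \<open>U\<close>. For $n \geq 2$ the closure
  of a $\delta$-neighbourhood is never a finite union of simplices, so the simplices are required to
  cover it and to meet \<open>U\<close>; the elements proper are the simplices truncated to the closure of \<open>U\<close>.
\<close>
definition mesh :: "(real^'n) set \<Rightarrow> real \<Rightarrow> (real^'n) set set \<Rightarrow> bool" where
  "mesh U h \<T> \<longleftrightarrow>
     finite \<T> \<and>
     (\<forall>K\<in>\<T>. int CARD('n) simplex K \<and> K \<inter> U \<noteq> {}) \<and>
     (\<forall>K\<in>\<T>. \<forall>L\<in>\<T>. (K \<inter> L) face_of K \<and> (K \<inter> L) face_of L) \<and>
     closure U \<subseteq> \<Union>\<T> \<and>
     Max (diameter ` \<T>) = h"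

text \<open>The radius of an inscribed ball of every element is comparable to the mesh size; this contains
  shape regularity.\<close>
definition quasi_uniform_meshes ::
  "(real^'n) set \<Rightarrow> (real \<Rightarrow> (real^'n) set set) \<Rightarrow> bool" where
  "quasi_uniform_meshes U \<T> \<longleftrightarrow>
     (\<forall>h>0. mesh U h (\<T> h)) \<and>
     (\<exists>\<sigma>>0. \<forall>h>0. \<forall>K\<in>\<T> h. \<exists>x. cball x (\<sigma> * h) \<subseteq> K)"

definition Xh_space ::
  "(real^'n) set \<Rightarrow> real \<Rightarrow> (real^'n) set set \<Rightarrow> (real^'n \<Rightarrow> real^'n) set" where
  "Xh_space \<Omega> \<delta> \<T> = {u. continuous_on (closure (Omega_ext \<Omega> \<delta>)) u \<and>
     (\<forall>K\<in>\<T>. \<exists>A c. linear A \<and> (\<forall>x \<in> K \<inter> closure (Omega_ext \<Omega> \<delta>). u x = A x + c)) \<and>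
     (\<forall>x \<in> Omega_ext \<Omega> \<delta> - \<Omega>. u x = 0)}"

text \<open>Neighbouring closed simplices share faces, so constancy on each element is only meaningful
  almost everywhere.\<close>
definition Zh_space :: "(real^'n) set \<Rightarrow> (real^'n) set set \<Rightarrow> (real^'n \<Rightarrow> real^'n) set" where
  "Zh_space \<Omega> \<T> = {z. \<forall>K\<in>\<T>. \<exists>c. AE x in lebesgue_on \<Omega>. x \<in> K \<longrightarrow> z x = c}"

definition Z_ad ::
  "(real^'n) set \<Rightarrow> (real^'n \<Rightarrow> real^'n) \<Rightarrow> (real^'n \<Rightarrow> real^'n) \<Rightarrow> (real^'n \<Rightarrow> real^'n) set" where
  "Z_ad \<Omega> a b = {z \<in> L2 \<Omega>. AE x in lebesgue_on \<Omega>. \<forall>i. a x $ i \<le> z x $ i \<and> z x $ i \<le> b x $ i}"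

definition objective :: "(real^'n) set \<Rightarrow> real \<Rightarrow> (real^'n \<Rightarrow> real^'n) \<Rightarrow> (real^'n \<Rightarrow> real^'n) \<Rightarrow> real" where
  "objective \<Omega> lam u g = 1/2 * (LINT x|lebesgue_on \<Omega>. (norm (u x))\<^sup>2)
                       + lam/2 * (LINT x|lebesgue_on \<Omega>. (norm (g x))\<^sup>2)"

text \<open>\<open>V\<close> is the space of states and of test functions, \<open>Z\<close> the set of controls.\<close>
definition optimal_pair :: "(real^'n) set \<Rightarrow> (real^'n \<Rightarrow> real) \<Rightarrow> (real \<Rightarrow> real) \<Rightarrow> real \<Rightarrow> real \<Rightarrow>
    (real^'n \<Rightarrow> real^'n) set \<Rightarrow> (real^'n \<Rightarrow> real^'n) set \<Rightarrow>
    (real^'n \<Rightarrow> real^'n) \<Rightarrow> (real^'n \<Rightarrow> real^'n) \<Rightarrow> bool" where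
  "optimal_pair \<Omega> \<kappa> k \<delta> lam V Z u g \<longleftrightarrow>
     is_arg_min (\<lambda>(u, g). objective \<Omega> lam u g)
       (\<lambda>(u, g). u \<in> V \<and> g \<in> Z \<and> (\<forall>v\<in>V. B_form \<Omega> \<kappa> k \<delta> u v = L2_inner \<Omega> g v)) (u, g)"

end

theory Submission
  imports Defs
begin

text \<open>
  Both discrete equations are Galerkin discretizations of the equations that define \<open>u_hat\<close> and
  \<open>p_hat\<close>, with the same right-hand sides. By Cea's lemma \<open>u_hat - uh\<close> and \<open>p_hat - ph\<close> are
  quasi-optimal; what remains, \<open>u - u_hat\<close> and \<open>p - p_hat\<close>, solves the continuous equation with
  data \<open>g - gh\<close> and \<open>u - uh\<close>, and is controlled by stability. This argument works for any symmetric
  form \<open>B\<close> that is equivalent to the square of the \<open>X\<close>-norm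
  (\<open>control_setting.state_and_adjoint_error\<close>). What has to be proved about the nonlocal problem is
  that the constants of this equivalence do not depend on \<open>\<delta>\<close>, and that finite element functions
  belong to \<open>X0_space\<close>.

  Since \<open>B\<close> is comparable to the square of the seminorm, uniform equivalence amounts to a
  Poincare-Korn inequality that is uniform in \<open>\<delta>\<close> (\<open>Poincare_Korn\<close>). For functions that vanish
  outside the bounded set \<open>\<Omega>\<close> it has a direct proof. Fix a vector \<open>\<xi>\<close> of
  length $0 < r < \delta$ with direction
  $w$, and let $f(x) = U(x) \cdot w$. Walking from a point of \<open>\<Omega>\<close> by steps of \<open>\<xi>\<close> one leaves \<open>\<Omega>\<close>
  after at most $N \leq (d + \delta)/r$ steps, where $d$ bounds the diameter, so $f$ is a
  telescoping sum of $N$ increments; Cauchy-Schwarz and translation invariance bound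
  the squared $L^2$ norm of $f$ by $(d + \delta)^2/r^2$ times that of the increment of $f$ by \<open>\<xi>\<close>.
  That increment is exactly what the seminorm sees, because the operator \<open>Dop\<close> projects differences
  of $U$ on the direction that joins the two points. Integrating against the kernel turns
  the left-hand side into
  the average of $(U \cdot w)^2$ over directions, which is $|U|^2/n$
  by radial symmetry (\<open>radial_integral_square_inner\<close>).

  A finite element function is Lipschitz along every segment inside the \<open>\<delta>\<close>-neighbourhood, and the
  kernel only sees pairs of points joined by such segments, so its integrand is dominated by a
  multiple of the kernel (\<open>Xh_subset_X0\<close>).
\<close>

section \<open>Galerkin approximation for semi-inner products\<close>

text \<open>
  Functions that agree almost everywhere are not identified, so the forms are only
  semi-definite; and the spaces consist of total functions, so they are subsets closed under
  pointwise linear combination instead of types.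
\<close>

locale semi_inner =
  fixes V :: "('a \<Rightarrow> 'b::real_vector) set" and Q :: "('a \<Rightarrow> 'b) \<Rightarrow> ('a \<Rightarrow> 'b) \<Rightarrow> real"
  assumes closed: "u \<in> V \<Longrightarrow> v \<in> V \<Longrightarrow> (\<lambda>x. u x + c *\<^sub>R v x) \<in> V"
    and lin: "u \<in> V \<Longrightarrow> v \<in> V \<Longrightarrow> w \<in> V \<Longrightarrow> Q (\<lambda>x. u x + c *\<^sub>R v x) w = Q u w + c * Q v w"
    and sym: "u \<in> V \<Longrightarrow> v \<in> V \<Longrightarrow> Q u v = Q v u"
    and nonneg: "u \<in> V \<Longrightarrow> 0 \<le> Q u u"
begin

definition seminorm :: "('a \<Rightarrow> 'b) \<Rightarrow> real" where
  "seminorm u = sqrt (Q u u)"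

lemma seminorm_ge_0: "u \<in> V \<Longrightarrow> 0 \<le> seminorm u"
  by (simp add: seminorm_def nonneg)

lemma power2_seminorm: "u \<in> V \<Longrightarrow> (seminorm u)\<^sup>2 = Q u u"
  by (simp add: seminorm_def nonneg)

lemma closed_diff: "u \<in> V \<Longrightarrow> v \<in> V \<Longrightarrow> (\<lambda>x. u x - v x) \<in> V"
  using closed[of u v "-1"] by simp

lemma lin_diff: "u \<in> V \<Longrightarrow> v \<in> V \<Longrightarrow> w \<in> V \<Longrightarrow> Q (\<lambda>x. u x - v x) w = Q u w - Q v w"
  using lin[of u v w "-1"] by simp

lemma square_expansion:
  assumes "u \<in> V" "v \<in> V"
  shows "Q (\<lambda>x. u x + c *\<^sub>R v x) (\<lambda>x. u x + c *\<^sub>R v x) = Q u u + 2 * c * Q u v + c\<^sup>2 * Q v v"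
proof -
  let ?w = "\<lambda>x. u x + c *\<^sub>R v x"
  have w: "?w \<in> V" using assms closed by blast
  have "Q ?w ?w = Q u ?w + c * Q v ?w" using lin assms w by blast
  also have "\<dots> = Q ?w u + c * Q ?w v" using sym assms w by simp
  also have "\<dots> = (Q u u + c * Q v u) + c * (Q u v + c * Q v v)" using lin assms by simp
  also have "\<dots> = Q u u + 2 * c * Q u v + c\<^sup>2 * Q v v"
    using sym[of u v] assms by (simp add: algebra_simps power2_eq_square)
  finally show ?thesis .
qed

lemma Cauchy_Schwarz:
  assumes u: "u \<in> V" and v: "v \<in> V"
  shows "\<bar>Q u v\<bar> \<le> seminorm u * seminorm v"
proof -
  have *: "0 \<le> Q u u + 2 * c * Q u v + c\<^sup>2 * Q v v" for c
    using square_expansion[OF u v, of c] nonneg[OF closed[OF u v, of c]] by simp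
  have "(Q u v)\<^sup>2 \<le> Q u u * Q v v"
  proof (cases "Q v v = 0")
    case False
    then have pos: "0 < Q v v" using nonneg[OF v] by simp
    have "0 \<le> Q u u - (Q u v)\<^sup>2 / Q v v"
      using *[of "- Q u v / Q v v"] False by (simp add: field_simps power2_eq_square)
    then show ?thesis using pos by (simp add: field_simps)
  next
    case True
    have "Q u v = 0"
    proof (rule ccontr)
      assume "Q u v \<noteq> 0"
      then show False
        using *[of "- (Q u u + 1) / (2 * Q u v)"] True by (simp add: field_simps)
    qed
    then show ?thesis using True by simp
  qed
  then have "sqrt ((Q u v)\<^sup>2) \<le> sqrt (Q u u * Q v v)" by (rule real_sqrt_le_mono)
  then show ?thesis by (simp add: seminorm_def real_sqrt_mult)
qed

lemma seminorm_triangle: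
  assumes u: "u \<in> V" and v: "v \<in> V" and w: "w \<in> V"
  shows "seminorm (\<lambda>x. u x - w x) \<le> seminorm (\<lambda>x. u x - v x) + seminorm (\<lambda>x. v x - w x)"
proof (rule power2_le_imp_le)
  let ?a = "\<lambda>x. u x - v x" and ?b = "\<lambda>x. v x - w x"
  have ab: "?a \<in> V" "?b \<in> V" using assms closed_diff by auto
  have "(seminorm (\<lambda>x. u x - w x))\<^sup>2 = Q ?a ?a + 2 * Q ?a ?b + Q ?b ?b"
    using square_expansion[OF ab, of 1] power2_seminorm[OF closed_diff[OF u w]] by simp
  also have "\<dots> \<le> (seminorm ?a + seminorm ?b)\<^sup>2"
    using Cauchy_Schwarz[OF ab] power2_seminorm[OF ab(1)] power2_seminorm[OF ab(2)]
    by (simp add: power2_sum)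
  finally show "(seminorm (\<lambda>x. u x - w x))\<^sup>2 \<le> (seminorm ?a + seminorm ?b)\<^sup>2" .
  show "0 \<le> seminorm ?a + seminorm ?b" using ab seminorm_ge_0 by simp
qed

text \<open>
  The error is \<open>Q\<close>-orthogonal to \<open>S\<close>, so in \<open>Q (u - us) (u - us)\<close> the second argument may be
  replaced by \<open>u - v\<close>; Cauchy-Schwarz then cancels one factor.
\<close>

lemma Cea:
  assumes S: "S \<subseteq> V" and u: "u \<in> V" and us: "us \<in> S" and v: "v \<in> S"
    and Sdiff: "(\<lambda>x. v x - us x) \<in> S"
    and orth: "\<And>s. s \<in> S \<Longrightarrow> Q u s = Q us s"
  shows "seminorm (\<lambda>x. u x - us x) \<le> seminorm (\<lambda>x. u x - v x)"
proof -
  let ?e = "\<lambda>x. u x - us x" and ?d = "\<lambda>x. v x - us x" and ?f = "\<lambda>x. u x - v x"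
  have V: "us \<in> V" "v \<in> V" "?e \<in> V" "?f \<in> V" "?d \<in> V"
    using S u us v Sdiff closed_diff by auto
  have eq: "(\<lambda>x. ?f x + 1 *\<^sub>R ?d x) = ?e" by auto
  have "Q ?e ?d = 0" using lin_diff[OF u V(1) V(5)] orth[OF Sdiff] by simp
  moreover have "Q ?e ?e = Q ?f ?e + Q ?d ?e"
    using lin[OF V(4) V(5) V(3), of 1] unfolding eq by simp
  ultimately have "Q ?e ?e = Q ?f ?e" using sym V by simp
  then have "(seminorm ?e)\<^sup>2 \<le> seminorm ?f * seminorm ?e"
    using Cauchy_Schwarz[OF V(4,3)] power2_seminorm[OF V(3)] by linarith
  then have "seminorm ?e * seminorm ?e \<le> seminorm ?f * seminorm ?e"
    by (simp only: power2_eq_square)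
  then show ?thesis
    using seminorm_ge_0[OF V(3)] seminorm_ge_0[OF V(4)]
    by (auto simp only: mult_le_cancel_right)
qed

end

lemma semi_inner_subset:
  assumes "semi_inner W Q" "V \<subseteq> W" "\<And>u v c. u \<in> V \<Longrightarrow> v \<in> V \<Longrightarrow> (\<lambda>x. u x + c *\<^sub>R v x) \<in> V"
  shows "semi_inner V Q"
proof -
  interpret semi_inner W Q by fact
  show ?thesis
  proof (rule semi_inner.intro)
    fix u v w and c :: real assume "u \<in> V" "v \<in> V" "w \<in> V"
    then show "Q (\<lambda>x. u x + c *\<^sub>R v x) w = Q u w + c * Q v w"
      and "Q u v = Q v u" and "0 \<le> Q u u" and "(\<lambda>x. u x + c *\<^sub>R v x) \<in> V"
      using lin[of u v w c] sym[of u v] nonneg[of u] assms(2) assms(3)[of u v c] by auto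
  qed
qed

lemma semi_inner_add:
  assumes "semi_inner V P" "semi_inner V Q" "0 \<le> (c::real)"
  shows "semi_inner V (\<lambda>u v. P u v + c * Q u v)"
proof -
  interpret P: semi_inner V P by fact
  interpret Q: semi_inner V Q by fact
  show ?thesis
  proof
    show "P u v + c * Q u v = P v u + c * Q v u" if "u \<in> V" "v \<in> V" for u v
      using P.sym[OF that] Q.sym[OF that] by simp
    show "P (\<lambda>x. u x + d *\<^sub>R v x) w + c * Q (\<lambda>x. u x + d *\<^sub>R v x) w
      = P u w + c * Q u w + d * (P v w + c * Q v w)" if "u \<in> V" "v \<in> V" "w \<in> V" for u v w d
      using P.lin[OF that, of d] Q.lin[OF that, of d] by (simp add: algebra_simps)
    show "0 \<le> P u u + c * Q u u" if "u \<in> V" for u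
      using P.nonneg[OF that] Q.nonneg[OF that] assms(3) by simp
  qed (rule P.closed)
qed

lemma le_mult_INF_add:
  fixes F :: "'a \<Rightarrow> real"
  assumes "S \<noteq> {}" "0 < A" "\<And>v. v \<in> S \<Longrightarrow> x \<le> A * (F v + c)"
  shows "x \<le> A * ((INF v\<in>S. F v) + c)"
proof -
  have "x / A - c \<le> (INF v\<in>S. F v)"
    using assms by (intro cINF_greatest) (auto simp: field_simps)
  then show ?thesis using \<open>0 < A\<close> by (simp add: field_simps)
qed

text \<open>
  \<open>L\<close> is the inner product of the data space \<open>W\<close>, \<open>N\<close> that of the energy space \<open>V\<close>, \<open>B\<close> the form of
  the state equation and \<open>S\<close> the Galerkin space. The constants enter squared because the
  estimates are between seminorms.
\<close>

locale control_setting =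
  fixes W V :: "('a \<Rightarrow> 'b::real_vector) set" and S and L B N :: "('a \<Rightarrow> 'b) \<Rightarrow> ('a \<Rightarrow> 'b) \<Rightarrow> real"
    and m M :: real
  assumes L: "semi_inner W L" and B: "semi_inner V B" and N: "semi_inner V N"
    and VW: "V \<subseteq> W" and SV: "S \<subseteq> V"
    and S_diff: "\<And>u v. u \<in> S \<Longrightarrow> v \<in> S \<Longrightarrow> (\<lambda>x. u x - v x) \<in> S"
    and L_le_N: "\<And>u. u \<in> V \<Longrightarrow> L u u \<le> N u u"
    and coercive: "\<And>u. u \<in> V \<Longrightarrow> N u u \<le> m\<^sup>2 * B u u"
    and bounded: "\<And>u. u \<in> V \<Longrightarrow> B u u \<le> M\<^sup>2 * N u u"
    and m: "0 \<le> m" and M: "0 \<le> M"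
begin

sublocale L: semi_inner W L by (rule L)
sublocale B: semi_inner V B by (rule B)
sublocale N: semi_inner V N by (rule N)

lemma L_seminorm_le: "u \<in> V \<Longrightarrow> L.seminorm u \<le> N.seminorm u"
  using L_le_N by (simp add: L.seminorm_def N.seminorm_def)

lemma N_seminorm_le: "u \<in> V \<Longrightarrow> N.seminorm u \<le> m * B.seminorm u"
  using real_sqrt_le_mono[OF coercive, of u] m
  by (simp add: B.seminorm_def N.seminorm_def real_sqrt_mult)

lemma B_seminorm_le: "u \<in> V \<Longrightarrow> B.seminorm u \<le> M * N.seminorm u"
  using real_sqrt_le_mono[OF bounded, of u] M
  by (simp add: B.seminorm_def N.seminorm_def real_sqrt_mult)

text \<open>
  The energy identity of a solution \<open>w\<close> with data \<open>f\<close>: Cauchy-Schwarz in \<open>W\<close> leaves one factor that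
  coercivity absorbs into the energy.
\<close>

lemma stability:
  assumes w: "w \<in> V" and f: "f \<in> W" and eq: "B w w = L f w"
  shows "B.seminorm w \<le> m * L.seminorm f"
proof -
  have wW: "w \<in> W" using w VW by auto
  have "(B.seminorm w)\<^sup>2 \<le> L.seminorm f * L.seminorm w"
    using B.power2_seminorm[OF w] eq L.Cauchy_Schwarz[OF f wW] by linarith
  also have "\<dots> \<le> L.seminorm f * (m * B.seminorm w)"
    using L_seminorm_le[OF w] N_seminorm_le[OF w] L.seminorm_ge_0[OF f]
    by (intro mult_left_mono) auto
  finally have "B.seminorm w * B.seminorm w \<le> (m * L.seminorm f) * B.seminorm w"
    by (simp add: power2_eq_square algebra_simps)
  then show ?thesis
    using B.seminorm_ge_0[OF w] mult_nonneg_nonneg[OF m L.seminorm_ge_0[OF f]]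
    by (auto simp only: mult_le_cancel_right)
qed

text \<open>
  The function \<open>w\<close> solves the continuous problem with the discrete data \<open>fh\<close>. It splits the error:
  \<open>u - w\<close> is a solution with data \<open>f - fh\<close>, and \<open>w - uh\<close> is a Galerkin error.
\<close>

lemma error_estimate:
  assumes u: "u \<in> V" and uh: "uh \<in> S" and w: "w \<in> V" and f: "f \<in> W" and fh: "fh \<in> W"
    and u_eq: "\<And>v. v \<in> V \<Longrightarrow> B u v = L f v"
    and w_eq: "\<And>v. v \<in> V \<Longrightarrow> B w v = L fh v"
    and uh_eq: "\<And>v. v \<in> S \<Longrightarrow> B uh v = L fh v"
    and v: "v \<in> S"
  shows "N.seminorm (\<lambda>x. u x - uh x)
    \<le> m * (m + M) * (N.seminorm (\<lambda>x. w x - v x) + L.seminorm (\<lambda>x. f x - fh x))"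
proof -
  have uhV: "uh \<in> V" and vV: "v \<in> V" using uh v SV by auto
  let ?r = "\<lambda>x. u x - w x" and ?f = "\<lambda>x. f x - fh x"
  have rV: "?r \<in> V" using u w B.closed_diff by blast
  have fW: "?f \<in> W" using f fh L.closed_diff by blast
  have wvV: "(\<lambda>x. w x - v x) \<in> V" using w vV B.closed_diff by blast
  have "B ?r ?r = L ?f ?r"
    using B.lin_diff[OF u w rV] L.lin_diff[OF f fh] rV VW u_eq w_eq by auto
  then have 1: "B.seminorm ?r \<le> m * L.seminorm ?f" using stability rV fW by blast
  \<comment> \<open>In the energy norm of \<open>B\<close> Cea's lemma has constant 1; the comparison with \<open>N\<close> is paid once.\<close>
  have "B.seminorm (\<lambda>x. w x - uh x) \<le> B.seminorm (\<lambda>x. w x - v x)"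
    using SV w uh v S_diff[OF v uh] w_eq uh_eq by (intro B.Cea[of S]) auto
  also have "\<dots> \<le> M * N.seminorm (\<lambda>x. w x - v x)" using B_seminorm_le wvV by blast
  finally have 2: "B.seminorm (\<lambda>x. w x - uh x) \<le> M * N.seminorm (\<lambda>x. w x - v x)" .
  have "N.seminorm (\<lambda>x. u x - uh x) \<le> m * B.seminorm (\<lambda>x. u x - uh x)"
    using N_seminorm_le B.closed_diff u uhV by blast
  also have "\<dots> \<le> m * (B.seminorm ?r + B.seminorm (\<lambda>x. w x - uh x))"
    using B.seminorm_triangle[OF u w uhV] m by (intro mult_left_mono) auto
  also have "\<dots> \<le> m * (m * L.seminorm ?f + M * N.seminorm (\<lambda>x. w x - v x))"
    using 1 2 m by (intro mult_left_mono) auto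
  also have "\<dots> \<le> m * ((m + M) * L.seminorm ?f + (m + M) * N.seminorm (\<lambda>x. w x - v x))"
    using m M N.seminorm_ge_0[OF wvV] L.seminorm_ge_0[OF fW]
    by (intro mult_left_mono add_mono mult_right_mono) auto
  finally show ?thesis by (simp add: algebra_simps)
qed

text \<open>
  Both estimates are instances of \<open>error_estimate\<close>. For the adjoint the data are the states \<open>u\<close> and
  \<open>uh\<close>, so the state error appears on the right-hand side and is replaced by its own bound; this
  produces the square of \<open>A\<close>.
\<close>

theorem state_and_adjoint_error:
  assumes m_pos: "0 < m" and S_ne: "S \<noteq> {}"
    and u: "u \<in> V" "\<And>v. v \<in> V \<Longrightarrow> B u v = L g v"
    and p: "p \<in> V" "\<And>v. v \<in> V \<Longrightarrow> B v p = L u v"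
    and uh: "uh \<in> S" "\<And>v. v \<in> S \<Longrightarrow> B uh v = L gh v"
    and ph: "ph \<in> S" "\<And>v. v \<in> S \<Longrightarrow> B v ph = L uh v"
    and u_hat: "u_hat \<in> V" "\<And>v. v \<in> V \<Longrightarrow> B u_hat v = L gh v"
    and p_hat: "p_hat \<in> V" "\<And>v. v \<in> V \<Longrightarrow> B v p_hat = L v uh"
    and g: "g \<in> W" and gh: "gh \<in> W"
  defines "A \<equiv> m * (m + M)"
  shows "N.seminorm (\<lambda>x. u x - uh x) \<le> (A + A\<^sup>2) *
      ((INF v\<in>S. N.seminorm (\<lambda>x. u_hat x - v x)) + L.seminorm (\<lambda>x. g x - gh x))" (is "_ \<le> _ * (?Iu + ?g)")
    and "N.seminorm (\<lambda>x. p x - ph x) \<le> (A + A\<^sup>2) * ((INF v\<in>S. N.seminorm (\<lambda>x. p_hat x - v x))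
      + (INF v\<in>S. N.seminorm (\<lambda>x. u_hat x - v x)) + L.seminorm (\<lambda>x. g x - gh x))" (is "_ \<le> _ * (?Ip + _ + _)")
proof -
  have A: "0 < A" using m_pos M by (simp add: A_def)
  have V: "uh \<in> V" "ph \<in> V" using uh ph SV by auto
  have W: "u \<in> W" "uh \<in> W" using u V VW by auto
  have INF_ge_0: "0 \<le> (INF v\<in>S. N.seminorm (\<lambda>x. w x - v x))" if "w \<in> V" for w
    using SV that by (intro cINF_greatest S_ne N.seminorm_ge_0 N.closed_diff) auto
  have g_ge_0: "0 \<le> ?g" using g gh by (intro L.seminorm_ge_0 L.closed_diff)
  have 1: "N.seminorm (\<lambda>x. u x - uh x) \<le> A * (?Iu + ?g)"
    unfolding A_def
    using error_estimate[OF u(1) uh(1) u_hat(1) g gh u(2) u_hat(2) uh(2)] A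
    by (intro le_mult_INF_add S_ne) (simp_all add: A_def)
  have "A * (?Iu + ?g) \<le> (A + A\<^sup>2) * (?Iu + ?g)"
    using INF_ge_0[OF u_hat(1)] g_ge_0 A by (intro mult_right_mono) auto
  with 1 show "N.seminorm (\<lambda>x. u x - uh x) \<le> (A + A\<^sup>2) * (?Iu + ?g)" by linarith
  have Bp: "B p v = L u v" if "v \<in> V" for v using p(2)[OF that] B.sym[OF p(1) that] by simp
  have Bp_hat: "B p_hat v = L uh v" if "v \<in> V" for v
    using p_hat(2)[OF that] B.sym[OF p_hat(1) that] L.sym[of v uh] W(2) VW that by auto
  have Bph: "B ph v = L uh v" if "v \<in> S" for v
    using ph(2)[OF that] B.sym[of ph v] V(2) SV that by auto
  have "N.seminorm (\<lambda>x. p x - ph x) \<le> A * (?Ip + L.seminorm (\<lambda>x. u x - uh x))"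
    unfolding A_def
    using error_estimate[OF p(1) ph(1) p_hat(1) W Bp Bp_hat Bph] A
    by (intro le_mult_INF_add S_ne) (simp_all add: A_def)
  also have "\<dots> \<le> A * (?Ip + A * (?Iu + ?g))"
    using L_seminorm_le[OF B.closed_diff[OF u(1) V(1)]] 1 A by (intro mult_left_mono) auto
  also have "\<dots> = A * ?Ip + A\<^sup>2 * (?Iu + ?g)" by (simp add: power2_eq_square algebra_simps)
  also have "\<dots> \<le> (A + A\<^sup>2) * ?Ip + (A + A\<^sup>2) * (?Iu + ?g)"
    using INF_ge_0[OF u_hat(1)] INF_ge_0[OF p_hat(1)] g_ge_0 A by (intro add_mono mult_right_mono) auto
  finally show "N.seminorm (\<lambda>x. p x - ph x) \<le> (A + A\<^sup>2) * (?Ip + ?Iu + ?g)"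
    by (simp add: algebra_simps)
qed

end

section \<open>Second moments of a radial kernel\<close>

lemma borel_measurable_vec_nth [measurable (raw)]:
  fixes f :: "'a \<Rightarrow> real^'n::finite"
  assumes "f \<in> borel_measurable M"
  shows "(\<lambda>x. f x $ i) \<in> borel_measurable M"
  using borel_measurable_inner[OF assms borel_measurable_const, of "axis i 1"] by (simp add: inner_axis)

text \<open>
  Permutations and reflections of the coordinates map boxes to boxes of the same volume. These
  two kinds of isometries already determine the second moments of a radial function.
\<close>

lemma lborel_distr_coordinate_permutation:
  fixes \<pi> :: "'n::finite \<Rightarrow> 'n"
  assumes "bij \<pi>"
  shows "distr lborel borel (\<lambda>x::real^'n. \<chi> i. x $ \<pi> i) = lborel"
proof (rule lborel_eqI[symmetric])
  have meas: "(\<lambda>x::real^'n. \<chi> i. x $ \<pi> i) \<in> borel_measurable borel"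
    by (intro borel_measurable_continuous_onI continuous_intros)
  fix l u :: "real^'n"
  assume le: "\<And>b. b \<in> Basis \<Longrightarrow> l \<bullet> b \<le> u \<bullet> b"
  have le': "l $ i \<le> u $ i" for i using le[of "axis i 1"] by (simp add: inner_axis)
  let ?l = "\<chi> i. l $ inv \<pi> i" and ?u = "\<chi> i. u $ inv \<pi> i"
  have inv: "inv \<pi> (\<pi> i) = i" "\<pi> (inv \<pi> i) = i" for i
    using assms by (simp_all add: bij_is_inj bij_is_surj surj_f_inv_f)
  have pre: "(\<lambda>x::real^'n. \<chi> i. x $ \<pi> i) -` box l u \<inter> space lborel = box ?l ?u"
    by (auto simp: mem_box_cart inv) (metis inv)+
  have prod_axis: "(\<Prod>b\<in>(Basis::(real^'n) set). x \<bullet> b) = (\<Prod>i\<in>UNIV. x $ i)" for x :: "real^'n"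
    by (subst prod.reindex_bij_betw[of "\<lambda>i. axis i 1" UNIV, symmetric])
       (auto simp: bij_betw_def inj_on_def axis_eq_axis Basis_vec_def inner_axis)
  have "emeasure (distr lborel borel (\<lambda>x::real^'n. \<chi> i. x $ \<pi> i)) (box l u) = emeasure lborel (box ?l ?u)"
    using meas pre by (simp add: emeasure_distr)
  also have "\<dots> = (\<Prod>b\<in>Basis. (?u - ?l) \<bullet> b)"
    by (rule emeasure_lborel_box) (auto simp: Basis_vec_def inner_axis le')
  also have "(\<Prod>b\<in>Basis. (?u - ?l) \<bullet> b) = (\<Prod>i\<in>UNIV. (u - l) $ inv \<pi> i)"
    unfolding prod_axis by simp
  also have "\<dots> = (\<Prod>i\<in>UNIV. (u - l) $ i)"
    by (rule prod.reindex_bij_betw) (simp add: assms bij_imp_bij_inv)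
  also have "\<dots> = (\<Prod>b\<in>Basis. (u - l) \<bullet> b)" unfolding prod_axis ..
  finally show "emeasure (distr lborel borel (\<lambda>x::real^'n. \<chi> i. x $ \<pi> i)) (box l u) = (\<Prod>b\<in>Basis. (u - l) \<bullet> b)" .
qed simp

lemma lborel_distr_coordinate_reflection:
  fixes j :: "'n::finite"
  shows "distr lborel borel (\<lambda>x::real^'n. \<chi> i. (if i = j then - 1 else 1) * x $ i) = lborel"
proof (rule lborel_eqI[symmetric])
  let ?T = "\<lambda>x::real^'n. \<chi> i. (if i = j then - 1 else 1) * x $ i"
  have meas: "?T \<in> borel_measurable borel"
    by (intro borel_measurable_continuous_onI continuous_intros)
  fix l u :: "real^'n"
  assume le: "\<And>b. b \<in> Basis \<Longrightarrow> l \<bullet> b \<le> u \<bullet> b"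
  have le': "l $ i \<le> u $ i" for i using le[of "axis i 1"] by (simp add: inner_axis)
  let ?l = "\<chi> i. if i = j then - u $ i else l $ i" and ?u = "\<chi> i. if i = j then - l $ i else u $ i"
  have pre: "?T -` box l u \<inter> space lborel = box ?l ?u"
    by (intro set_eqI, simp add: mem_box_cart) (intro all_cong1, auto)
  have "emeasure (distr lborel borel ?T) (box l u) = emeasure lborel (box ?l ?u)"
    using meas pre by (simp add: emeasure_distr)
  also have "\<dots> = (\<Prod>b\<in>Basis. (?u - ?l) \<bullet> b)"
    by (rule emeasure_lborel_box) (auto simp: Basis_vec_def inner_axis le')
  also have "\<dots> = (\<Prod>b\<in>Basis. (u - l) \<bullet> b)"
    by (intro arg_cong[where f=ennreal] prod.cong) (auto simp: Basis_vec_def inner_axis)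
  finally show "emeasure (distr lborel borel ?T) (box l u) = (\<Prod>b\<in>Basis. (u - l) \<bullet> b)" .
qed simp

lemma integral_lborel_invariant:
  fixes f :: "real^'n::finite \<Rightarrow> real"
  assumes "distr lborel borel T = lborel" "T \<in> borel_measurable borel" "f \<in> borel_measurable borel"
  shows "(LINT x|lborel. f (T x)) = (LINT x|lborel. f x)"
  using integral_distr[of T lborel borel f] assms by simp

text \<open>
  The matrix of second moments of a radial weight is invariant under coordinate reflections, hence
  diagonal, and under transpositions, hence a multiple of the identity; its trace is the mass of
  the weight. The origin carries no direction, hence its removal on the right-hand side.
\<close>

lemma radial_integral_square_inner:
  fixes k :: "real \<Rightarrow> real" and a :: "real^'n::finite"
  assumes k[measurable]: "k \<in> borel_measurable borel"
    and int: "integrable lborel (\<lambda>\<xi>::real^'n. k (norm \<xi>))"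
  shows "integrable lborel (\<lambda>\<xi>::real^'n. k (norm \<xi>) * (a \<bullet> (\<xi> /\<^sub>R norm \<xi>))\<^sup>2)"
    and "CARD('n) * (LINT \<xi>|lborel. k (norm \<xi>) * (a \<bullet> (\<xi> /\<^sub>R norm \<xi>))\<^sup>2)
      = (norm a)\<^sup>2 * (LINT \<xi>:(UNIV - {0::real^'n})|lborel. k (norm \<xi>))"
proof -
  let ?w = "\<lambda>(\<xi>::real^'n) i. (\<xi> /\<^sub>R norm \<xi>) $ i"
  let ?I = "\<lambda>i j. LINT \<xi>|lborel. k (norm \<xi>) * (?w \<xi> i * ?w \<xi> j)"
  have w_le: "\<bar>?w \<xi> i\<bar> \<le> 1" for \<xi> i
    using component_le_norm_cart[of "\<xi> /\<^sub>R norm \<xi>" i] by (cases "\<xi> = 0") auto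
  have Iint: "integrable lborel (\<lambda>\<xi>. k (norm \<xi>) * (?w \<xi> i * ?w \<xi> j))" for i j
  proof (rule Bochner_Integration.integrable_bound[OF int])
    show "AE \<xi> in lborel. norm (k (norm \<xi>) * (?w \<xi> i * ?w \<xi> j)) \<le> norm (k (norm \<xi>))"
      using mult_mono[OF w_le w_le] by (auto simp: abs_mult intro!: AE_I2 mult_left_le)
  qed measurable
  have off: "?I i j = 0" if "i \<noteq> j" for i j
  proof -
    let ?T = "\<lambda>x::real^'n. \<chi> l. (if l = i then - 1 else 1) * x $ l"
    have nT: "norm (?T x) = norm x" for x
      unfolding norm_vec_def L2_set_def by (intro arg_cong[where f=sqrt] sum.cong) auto
    have T: "?T \<in> borel_measurable borel"
      by (intro borel_measurable_continuous_onI continuous_intros)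
    have "?I i j = (LINT x|lborel. k (norm (?T x)) * (?w (?T x) i * ?w (?T x) j))"
      by (rule integral_lborel_invariant[symmetric, OF lborel_distr_coordinate_reflection T]) measurable
    also have "\<dots> = (LINT x|lborel. - (k (norm x) * (?w x i * ?w x j)))"
      unfolding nT using that by simp
    finally show ?thesis by simp
  qed
  have diag: "?I i i = ?I j j" for i j
  proof -
    let ?p = "Transposition.transpose i j"
    let ?T = "\<lambda>x::real^'n. \<chi> l. x $ ?p l"
    have bij: "bij ?p" by simp
    have nT: "norm (?T x) = norm x" for x
      unfolding norm_vec_def L2_set_def
      by (simp add: sum.reindex_bij_betw[OF bij, of "\<lambda>l. (norm (x $ l))\<^sup>2"] del: real_norm_def)
    have T: "?T \<in> borel_measurable borel"
      by (intro borel_measurable_continuous_onI continuous_intros)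
    have "?I i i = (LINT x|lborel. k (norm (?T x)) * (?w (?T x) i * ?w (?T x) i))"
      by (rule integral_lborel_invariant[symmetric, OF lborel_distr_coordinate_permutation[OF bij] T]) measurable
    also have "\<dots> = ?I j j" unfolding nT by simp
    finally show ?thesis .
  qed
  have exp: "k (norm \<xi>) * (a \<bullet> (\<xi> /\<^sub>R norm \<xi>))\<^sup>2
      = (\<Sum>i\<in>UNIV. \<Sum>j\<in>UNIV. a $ i * a $ j * (k (norm \<xi>) * (?w \<xi> i * ?w \<xi> j)))" for \<xi>
    by (simp only: inner_vec_def power2_eq_square sum_product sum_distrib_left inner_real_def mult_ac)
  show "integrable lborel (\<lambda>\<xi>::real^'n. k (norm \<xi>) * (a \<bullet> (\<xi> /\<^sub>R norm \<xi>))\<^sup>2)"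
    unfolding exp by (intro Bochner_Integration.integrable_sum integrable_mult_right Iint)
  have "(LINT \<xi>|lborel. k (norm \<xi>) * (a \<bullet> (\<xi> /\<^sub>R norm \<xi>))\<^sup>2)
      = (\<Sum>i\<in>UNIV. \<Sum>j\<in>UNIV. a $ i * a $ j * ?I i j)"
    unfolding exp
    by (simp only: Bochner_Integration.integral_sum Bochner_Integration.integrable_sum
        integrable_mult_right Iint integral_mult_right_zero)
  also have "\<dots> = (\<Sum>i\<in>UNIV. a $ i * a $ i * ?I i i)"
  proof (intro sum.cong refl)
    fix i
    have "a $ i * a $ j * ?I i j = (if j = i then a $ i * a $ i * ?I i i else 0)" for j
      using off[of i j] by (cases "j = i") auto
    then have "(\<Sum>j\<in>UNIV. a $ i * a $ j * ?I i j) = (\<Sum>j\<in>UNIV. if j = i then a $ i * a $ i * ?I i i else 0)"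
      by (intro sum.cong refl)
    also have "\<dots> = a $ i * a $ i * ?I i i" by (subst sum.delta) simp_all
    finally show "(\<Sum>j\<in>UNIV. a $ i * a $ j * ?I i j) = a $ i * a $ i * ?I i i" .
  qed
  finally have 1: "(LINT \<xi>|lborel. k (norm \<xi>) * (a \<bullet> (\<xi> /\<^sub>R norm \<xi>))\<^sup>2) = (\<Sum>i\<in>UNIV. a $ i * a $ i * ?I i i)" .
  have sum_w: "(\<Sum>j\<in>UNIV. ?w \<xi> j * ?w \<xi> j) = indicat_real (UNIV - {0}) \<xi>" for \<xi> :: "real^'n"
  proof -
    have "(\<Sum>j\<in>UNIV. ?w \<xi> j * ?w \<xi> j) = (\<xi> /\<^sub>R norm \<xi>) \<bullet> (\<xi> /\<^sub>R norm \<xi>)"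
      by (simp add: inner_vec_def)
    also have "\<dots> = (norm (\<xi> /\<^sub>R norm \<xi>))\<^sup>2" by (simp only: power2_norm_eq_inner)
    also have "\<dots> = indicat_real (UNIV - {0}) \<xi>" by (cases "\<xi> = 0") auto
    finally show ?thesis .
  qed
  have 2: "CARD('n) * ?I i i = (LINT \<xi>:(UNIV - {0::real^'n})|lborel. k (norm \<xi>))" for i
  proof -
    have "CARD('n) * ?I i i = (\<Sum>j\<in>(UNIV::'n set). ?I i i)" by simp
    also have "\<dots> = (\<Sum>j\<in>UNIV. ?I j j)" by (intro sum.cong refl diag)
    also have "\<dots> = (LINT \<xi>|lborel. (\<Sum>j\<in>UNIV. k (norm \<xi>) * (?w \<xi> j * ?w \<xi> j)))"
      by (rule Bochner_Integration.integral_sum[symmetric]) (rule Iint)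
    also have "\<dots> = (LINT \<xi>:(UNIV - {0::real^'n})|lborel. k (norm \<xi>))"
      unfolding set_lebesgue_integral_def
      by (simp only: sum_distrib_left[symmetric] sum_w) (simp add: mult.commute)
    finally show ?thesis .
  qed
  have "CARD('n) * (\<Sum>i\<in>UNIV. a $ i * a $ i * ?I i i) = (\<Sum>i\<in>UNIV. a $ i * a $ i * (CARD('n) * ?I i i))"
    by (simp add: sum_distrib_left mult_ac)
  also have "\<dots> = (norm a)\<^sup>2 * (LINT \<xi>:(UNIV - {0::real^'n})|lborel. k (norm \<xi>))"
    unfolding 2 by (simp add: power2_norm_eq_inner inner_vec_def sum_distrib_right)
  finally show "CARD('n) * (LINT \<xi>|lborel. k (norm \<xi>) * (a \<bullet> (\<xi> /\<^sub>R norm \<xi>))\<^sup>2)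
      = (norm a)\<^sup>2 * (LINT \<xi>:(UNIV - {0::real^'n})|lborel. k (norm \<xi>))"
    unfolding 1 .
qed

section \<open>A nonlocal Poincare-Korn inequality\<close>

lemma nn_integral_lborel_translate:
  fixes f :: "'a::euclidean_space \<Rightarrow> ennreal"
  assumes "f \<in> borel_measurable borel"
  shows "(\<integral>\<^sup>+x. f (c + x) \<partial>lborel) = (\<integral>\<^sup>+x. f x \<partial>lborel)"
proof -
  have "(\<integral>\<^sup>+x. f x \<partial>lborel) = (\<integral>\<^sup>+x. f x \<partial>distr lborel borel ((+) c))"
    by (simp only: lborel_distr_plus)
  also have "\<dots> = (\<integral>\<^sup>+x. f (c + x) \<partial>lborel)"
    using assms by (subst nn_integral_distr) auto
  finally show ?thesis ..
qed

text \<open>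
  A telescoping sum of \<open>N\<close> increments along \<open>\<xi>\<close>. Cauchy-Schwarz for the sum costs one factor \<open>N\<close>,
  and adding up \<open>N\<close> translates of the same integral costs the other.
\<close>

lemma Poincare_translation:
  fixes f :: "'a::euclidean_space \<Rightarrow> real"
  assumes [measurable]: "f \<in> borel_measurable borel"
    and zero: "\<And>x. x \<notin> \<Omega> \<Longrightarrow> f x = 0"
    and exit: "\<And>x. x \<in> \<Omega> \<Longrightarrow> x + real N *\<^sub>R \<xi> \<notin> \<Omega>"
  shows "(\<integral>\<^sup>+x. ennreal ((f x)\<^sup>2) \<partial>lborel)
    \<le> ennreal ((real N)\<^sup>2) * (\<integral>\<^sup>+x. ennreal ((f (x + \<xi>) - f x)\<^sup>2) \<partial>lborel)"
proof -
  let ?g = "\<lambda>x. (f (x + \<xi>) - f x)\<^sup>2"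
  have le: "(f x)\<^sup>2 \<le> real N * (\<Sum>j<N. ?g (real j *\<^sub>R \<xi> + x))" for x
  proof (cases "x \<in> \<Omega>")
    case True
    let ?h = "\<lambda>j. f (real j *\<^sub>R \<xi> + x)"
    have "(\<Sum>j<N. ?h (Suc j) - ?h j) = - f x"
      using zero[OF exit[OF True]] by (subst sum_lessThan_telescope) (simp add: add.commute)
    then have "(f x)\<^sup>2 = (\<Sum>j<N. ?h (Suc j) - ?h j)\<^sup>2" by simp
    also have "\<dots> \<le> real (card {..<N}) * (\<Sum>j<N. (?h (Suc j) - ?h j)\<^sup>2)"
      using sum_squared_le_sum_of_squares[of "\<lambda>j. ?h (Suc j) - ?h j" "{..<N}"] 
      by (simp add: mult.commute)
    also have "(\<Sum>j<N. (?h (Suc j) - ?h j)\<^sup>2) = (\<Sum>j<N. ?g (real j *\<^sub>R \<xi> + x))"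
      by (intro sum.cong refl) (simp add: algebra_simps)
    finally show ?thesis by simp
  next
    case False
    then show ?thesis using zero[OF False] by (simp add: sum_nonneg)
  qed
  have "(\<integral>\<^sup>+x. ennreal ((f x)\<^sup>2) \<partial>lborel)
      \<le> (\<integral>\<^sup>+x. ennreal (real N) * (\<Sum>j<N. ennreal (?g (real j *\<^sub>R \<xi> + x))) \<partial>lborel)"
  proof (rule nn_integral_mono)
    fix x
    show "ennreal ((f x)\<^sup>2) \<le> ennreal (real N) * (\<Sum>j<N. ennreal (?g (real j *\<^sub>R \<xi> + x)))"
      using ennreal_leI[OF le[of x]]
      by (simp only: ennreal_mult'[OF of_nat_0_le_iff] sum_ennreal zero_le_power2)
  qed
  also have "\<dots> = ennreal (real N) * (\<Sum>j<N. \<integral>\<^sup>+x. ennreal (?g (real j *\<^sub>R \<xi> + x)) \<partial>lborel)"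
    by (subst nn_integral_cmult, measurable) (subst nn_integral_sum, auto)
  also have "\<dots> = ennreal (real N) * (\<Sum>j<N. \<integral>\<^sup>+x. ennreal (?g x) \<partial>lborel)"
    by (subst nn_integral_lborel_translate[where f="\<lambda>x. ennreal (?g x)"]) simp_all
  also have "\<dots> = ennreal ((real N)\<^sup>2) * (\<integral>\<^sup>+x. ennreal (?g x) \<partial>lborel)"
    by (simp add: power2_eq_square ennreal_mult' mult.assoc flip: ennreal_of_nat_eq_real_of_nat)
  finally show ?thesis .
qed

lemma X_integrand_nonneg: "0 \<le> k (norm (fst z - snd z)) \<Longrightarrow> 0 \<le> X_integrand k u z"
  by (simp add: X_integrand_def case_prod_beta)

lemma borel_measurable_X_integrand [measurable (raw)]:
  fixes u :: "real^'n::finite \<Rightarrow> real^'n"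
  assumes [measurable]: "k \<in> borel_measurable borel" "u \<in> borel_measurable borel"
    "f \<in> M \<rightarrow>\<^sub>M borel \<Otimes>\<^sub>M borel"
  shows "(\<lambda>z. X_integrand k u (f z)) \<in> borel_measurable M"
  unfolding X_integrand_def Dop_def case_prod_beta by measurable

text \<open>
  The constant increases with \<open>\<delta>\<close>, hence is uniform over bounded horizons. Each \<open>\<xi>\<close> in the support of the
  kernel contributes separately, and the loss of order $1/|\xi|^2$ in the translation
  inequality is exactly the weight in the seminorm.
\<close>

theorem Poincare_Korn:
  fixes U :: "real^'n::finite \<Rightarrow> real^'n" and k :: "real \<Rightarrow> real" and d \<delta> :: real
  assumes k[measurable]: "k \<in> borel_measurable borel" and k_nonneg: "\<And>r. 0 \<le> k r"
    and k_supp: "\<And>r. \<delta> \<le> r \<Longrightarrow> k r = 0"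
    and k_mass: "(\<integral>\<^sup>+\<xi>. ennreal (k (norm \<xi>)) \<partial>(lborel :: (real^'n) measure)) = 1"
    and U[measurable]: "U \<in> borel_measurable borel" and zero: "\<And>x. x \<notin> \<Omega> \<Longrightarrow> U x = 0"
    and diam: "\<And>x y. x \<in> \<Omega> \<Longrightarrow> y \<in> \<Omega> \<Longrightarrow> norm (x - y) \<le> d" and "0 \<le> d" "0 < \<delta>"
  shows "(\<integral>\<^sup>+x. ennreal ((norm (U x))\<^sup>2) \<partial>lborel)
    \<le> ennreal (CARD('n) * (d + \<delta>)\<^sup>2) * (\<integral>\<^sup>+z. ennreal (X_integrand k U z) \<partial>(lborel \<Otimes>\<^sub>M lborel))"
proof -
  let ?c = "(d + \<delta>)\<^sup>2"
  let ?w = "\<lambda>\<xi>::real^'n. \<xi> /\<^sub>R norm \<xi>"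
  have slice: "(\<integral>\<^sup>+x. ennreal (k (norm \<xi>) * (U x \<bullet> ?w \<xi>)\<^sup>2) \<partial>lborel)
      \<le> ennreal ?c * (\<integral>\<^sup>+x. ennreal (X_integrand k U (x + \<xi>, x)) \<partial>lborel)" for \<xi>
  proof (cases "\<xi> = 0 \<or> \<delta> \<le> norm \<xi>")
    case True
    then show ?thesis using k_supp[of "norm \<xi>"] by auto
  next
    case False
    then have r: "0 < norm \<xi>" "norm \<xi> < \<delta>" by auto
    let ?f = "\<lambda>x. U x \<bullet> ?w \<xi>"
    \<comment> \<open>The least number of steps \<open>\<xi>\<close> whose total length exceeds the diameter bound.\<close>
    define N where "N = nat \<lfloor>d / norm \<xi>\<rfloor> + 1"
    have "d / norm \<xi> < real N" unfolding N_def using \<open>0 \<le> d\<close> r by simp linarith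
    then have N_gt: "d < real N * norm \<xi>" using r by (simp add: field_simps)
    have "real N \<le> d / norm \<xi> + 1" unfolding N_def using \<open>0 \<le> d\<close> r by simp
    then have "real N * norm \<xi> \<le> d + norm \<xi>" using r by (simp add: field_simps)
    then have "real N * norm \<xi> \<le> d + \<delta>" using r by linarith
    then have N_le: "(real N)\<^sup>2 \<le> ?c / (norm \<xi>)\<^sup>2"
      using power_mono[of "real N * norm \<xi>" "d + \<delta>" 2] r by (simp add: field_simps power_mult_distrib)
    have "(\<integral>\<^sup>+x. ennreal ((?f x)\<^sup>2) \<partial>lborel)
        \<le> ennreal ((real N)\<^sup>2) * (\<integral>\<^sup>+x. ennreal ((?f (x + \<xi>) - ?f x)\<^sup>2) \<partial>lborel)"
    proof (rule Poincare_translation)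
      fix x assume "x \<in> \<Omega>"
      show "x + real N *\<^sub>R \<xi> \<notin> \<Omega>"
        using diam[OF _ \<open>x \<in> \<Omega>\<close>, of "x + real N *\<^sub>R \<xi>"] N_gt by auto
    qed (simp_all add: zero)
    also have "\<dots> \<le> ennreal (?c / (norm \<xi>)\<^sup>2) * (\<integral>\<^sup>+x. ennreal ((?f (x + \<xi>) - ?f x)\<^sup>2) \<partial>lborel)"
      using N_le by (intro mult_right_mono ennreal_leI) auto
    finally have *: "(\<integral>\<^sup>+x. ennreal ((?f x)\<^sup>2) \<partial>lborel)
        \<le> ennreal (?c / (norm \<xi>)\<^sup>2) * (\<integral>\<^sup>+x. ennreal ((?f (x + \<xi>) - ?f x)\<^sup>2) \<partial>lborel)" .
    have X: "X_integrand k U (x + \<xi>, x) = (k (norm \<xi>) / (norm \<xi>)\<^sup>2) * (?f (x + \<xi>) - ?f x)\<^sup>2" for x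
      unfolding X_integrand_def Dop_def by (simp add: inner_diff_left right_diff_distrib)
    have "(\<integral>\<^sup>+x. ennreal (k (norm \<xi>) * (?f x)\<^sup>2) \<partial>lborel)
        = ennreal (k (norm \<xi>)) * (\<integral>\<^sup>+x. ennreal ((?f x)\<^sup>2) \<partial>lborel)"
      by (subst nn_integral_cmult[symmetric]) (simp_all add: ennreal_mult' k_nonneg)
    also have "\<dots> \<le> ennreal (k (norm \<xi>))
        * (ennreal (?c / (norm \<xi>)\<^sup>2) * (\<integral>\<^sup>+x. ennreal ((?f (x + \<xi>) - ?f x)\<^sup>2) \<partial>lborel))"
      using * by (rule mult_left_mono) simp
    also have "\<dots> = ennreal ?c * (ennreal (k (norm \<xi>) / (norm \<xi>)\<^sup>2)
        * (\<integral>\<^sup>+x. ennreal ((?f (x + \<xi>) - ?f x)\<^sup>2) \<partial>lborel))"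
      by (simp add: mult.assoc[symmetric] k_nonneg flip: ennreal_mult' ennreal_mult'') 
         (simp add: mult.commute)
    also have "ennreal (k (norm \<xi>) / (norm \<xi>)\<^sup>2) * (\<integral>\<^sup>+x. ennreal ((?f (x + \<xi>) - ?f x)\<^sup>2) \<partial>lborel)
        = (\<integral>\<^sup>+x. ennreal (X_integrand k U (x + \<xi>, x)) \<partial>lborel)"
      unfolding X ennreal_mult'[OF divide_nonneg_nonneg[OF k_nonneg zero_le_power2]]
      by (rule nn_integral_cmult[symmetric]) measurable
    finally show ?thesis .
  qed
  have k_int: "integrable lborel (\<lambda>\<xi>::real^'n. k (norm \<xi>))"
    by (rule integrableI_nonneg) (simp_all add: k_nonneg k_mass)
  have k_int1: "(LINT \<xi>:(UNIV - {0::real^'n})|lborel. k (norm \<xi>)) = 1"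
  proof -
    have "(LINT \<xi>:(UNIV - {0::real^'n})|lborel. k (norm \<xi>)) = (LINT \<xi>::real^'n|lborel. k (norm \<xi>))"
      unfolding set_lebesgue_integral_def
      by (rule integral_cong_AE) (use AE_lborel_singleton[of "0::real^'n"] in auto)
    also have "\<dots> = 1"
      by (subst integral_eq_nn_integral) (simp_all add: k_nonneg k_mass)
    finally show ?thesis .
  qed
  have radial: "ennreal ((norm (U x))\<^sup>2)
      = ennreal CARD('n) * (\<integral>\<^sup>+\<xi>. ennreal (k (norm \<xi>) * (U x \<bullet> ?w \<xi>)\<^sup>2) \<partial>lborel)" for x
  proof -
    note R = radial_integral_square_inner[OF k k_int, of "U x"]
    have "(\<integral>\<^sup>+\<xi>. ennreal (k (norm \<xi>) * (U x \<bullet> ?w \<xi>)\<^sup>2) \<partial>lborel)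
        = ennreal (LINT \<xi>|lborel. k (norm \<xi>) * (U x \<bullet> ?w \<xi>)\<^sup>2)"
      by (rule nn_integral_eq_integral[OF R(1)]) (simp add: k_nonneg)
    then show ?thesis
      using R(2) k_int1 by (simp flip: ennreal_mult' del: ennreal_of_nat_eq_real_of_nat)
  qed
  have "(\<integral>\<^sup>+x. ennreal ((norm (U x))\<^sup>2) \<partial>lborel)
      = ennreal CARD('n) * (\<integral>\<^sup>+x. \<integral>\<^sup>+\<xi>. ennreal (k (norm \<xi>) * (U x \<bullet> ?w \<xi>)\<^sup>2) \<partial>lborel \<partial>lborel)"
    unfolding radial by (rule nn_integral_cmult) measurable
  also have "(\<integral>\<^sup>+x. \<integral>\<^sup>+\<xi>. ennreal (k (norm \<xi>) * (U x \<bullet> ?w \<xi>)\<^sup>2) \<partial>lborel \<partial>lborel)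
      = (\<integral>\<^sup>+\<xi>. \<integral>\<^sup>+x. ennreal (k (norm \<xi>) * (U x \<bullet> ?w \<xi>)\<^sup>2) \<partial>lborel \<partial>lborel)"
    by (rule lborel_pair.Fubini') measurable
  also have "\<dots> \<le> (\<integral>\<^sup>+\<xi>. ennreal ?c * (\<integral>\<^sup>+x. ennreal (X_integrand k U (x + \<xi>, x)) \<partial>lborel) \<partial>lborel)"
    by (rule nn_integral_mono) (rule slice)
  also have "\<dots> = ennreal ?c * (\<integral>\<^sup>+\<xi>. \<integral>\<^sup>+x. ennreal (X_integrand k U (x + \<xi>, x)) \<partial>lborel \<partial>lborel)"
    by (rule nn_integral_cmult) measurable
  also have "(\<integral>\<^sup>+\<xi>. \<integral>\<^sup>+x. ennreal (X_integrand k U (x + \<xi>, x)) \<partial>lborel \<partial>lborel)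
      = (\<integral>\<^sup>+x. \<integral>\<^sup>+\<xi>. ennreal (X_integrand k U (x + \<xi>, x)) \<partial>lborel \<partial>lborel)"
    by (rule lborel_pair.Fubini') measurable
  also have "\<dots> = (\<integral>\<^sup>+x. \<integral>\<^sup>+y. ennreal (X_integrand k U (y, x)) \<partial>lborel \<partial>lborel)"
    by (subst nn_integral_lborel_translate[where f="\<lambda>y. ennreal (X_integrand k U (y, x))" for x]) simp_all
  also have "\<dots> = (\<integral>\<^sup>+y. \<integral>\<^sup>+x. ennreal (X_integrand k U (y, x)) \<partial>lborel \<partial>lborel)"
    by (rule lborel_pair.Fubini') measurable
  also have "\<dots> = (\<integral>\<^sup>+z. ennreal (X_integrand k U z) \<partial>(lborel \<Otimes>\<^sub>M lborel))"
    by (rule lborel.nn_integral_fst) measurable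
  finally show ?thesis
    by (simp add: mult.assoc ennreal_mult' mult_left_mono)
qed

section \<open>Lebesgue measurability on a product space\<close>

text \<open>
  Functions are only Lebesgue measurable, and Lebesgue measurability is not preserved by composition
  with an arbitrary continuous map. Projections are harmless because preimages of null sets under
  them are null.
\<close>

lemma vimage_fst_null_set:
  assumes "N \<in> null_sets (lborel :: 'a::euclidean_space measure)"
  shows "fst -` N \<in> null_sets (lborel :: ('a \<times> 'b::euclidean_space) measure)"
proof -
  have "emeasure (lborel \<Otimes>\<^sub>M lborel) (N \<times> (UNIV :: 'b set)) = emeasure lborel N * emeasure lborel (UNIV :: 'b set)"
    using assms by (intro lborel.emeasure_pair_measure_Times) auto
  then have "N \<times> (UNIV :: 'b set) \<in> null_sets (lborel \<Otimes>\<^sub>M lborel)"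
    using assms by (intro null_setsI pair_measureI) auto
  moreover have "fst -` N = N \<times> (UNIV :: 'b set)" by auto
  ultimately show ?thesis by (simp add: lborel_prod)
qed

lemma vimage_snd_null_set:
  assumes "N \<in> null_sets (lborel :: 'b::euclidean_space measure)"
  shows "snd -` N \<in> null_sets (lborel :: ('a::euclidean_space \<times> 'b) measure)"
proof -
  have "emeasure (lborel \<Otimes>\<^sub>M lborel) ((UNIV :: 'a set) \<times> N) = emeasure lborel (UNIV :: 'a set) * emeasure lborel N"
    using assms by (intro lborel.emeasure_pair_measure_Times) auto
  then have "(UNIV :: 'a set) \<times> N \<in> null_sets (lborel \<Otimes>\<^sub>M lborel)"
    using assms by (intro null_setsI pair_measureI) auto
  moreover have "snd -` N = (UNIV :: 'a set) \<times> N" by auto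
  ultimately show ?thesis by (simp add: lborel_prod)
qed

lemma measurable_fst_lebesgue:
  "(fst :: 'a::euclidean_space \<times> 'b::euclidean_space \<Rightarrow> 'a) \<in> lebesgue \<rightarrow>\<^sub>M lebesgue"
proof (rule completion.measurable_completion2)
  show m: "(fst :: 'a \<times> 'b \<Rightarrow> 'a) \<in> lebesgue \<rightarrow>\<^sub>M lborel"
    using measurable_completion[of fst lborel lborel] by (simp add: borel_prod[symmetric])
  show "null_sets lborel \<subseteq> null_sets (distr lebesgue lborel (fst :: 'a \<times> 'b \<Rightarrow> 'a))"
  proof
    fix N :: "'a set" assume N: "N \<in> null_sets lborel"
    have "fst -` N \<inter> space lebesgue \<in> null_sets (lebesgue :: ('a \<times> 'b) measure)"
      using null_sets_completionI[OF vimage_fst_null_set[OF N]] by simp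
    then show "N \<in> null_sets (distr lebesgue lborel (fst :: 'a \<times> 'b \<Rightarrow> 'a))"
      unfolding null_sets_distr_iff[OF m] using null_setsD2[OF N] by simp
  qed
qed

lemma measurable_snd_lebesgue:
  "(snd :: 'a::euclidean_space \<times> 'b::euclidean_space \<Rightarrow> 'b) \<in> lebesgue \<rightarrow>\<^sub>M lebesgue"
proof (rule completion.measurable_completion2)
  show m: "(snd :: 'a \<times> 'b \<Rightarrow> 'b) \<in> lebesgue \<rightarrow>\<^sub>M lborel"
    using measurable_completion[of snd lborel lborel] by (simp add: borel_prod[symmetric])
  show "null_sets lborel \<subseteq> null_sets (distr lebesgue lborel (snd :: 'a \<times> 'b \<Rightarrow> 'b))"
  proof
    fix N :: "'b set" assume N: "N \<in> null_sets lborel"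
    have "snd -` N \<inter> space lebesgue \<in> null_sets (lebesgue :: ('a \<times> 'b) measure)"
      using null_sets_completionI[OF vimage_snd_null_set[OF N]] by simp
    then show "N \<in> null_sets (distr lebesgue lborel (snd :: 'a \<times> 'b \<Rightarrow> 'b))"
      unfolding null_sets_distr_iff[OF m] using null_setsD2[OF N] by simp
  qed
qed

lemma AE_fst_snd:
  assumes "AE x in (lborel :: 'a::euclidean_space measure). P x"
  shows "AE z in (lborel :: ('a \<times> 'a) measure). P (fst z) \<and> P (snd z)"
proof -
  obtain N where N: "N \<in> null_sets (lborel :: 'a measure)" "{x. \<not> P x} \<subseteq> N"
    using assms by (auto simp: eventually_ae_filter)
  have "fst -` N \<union> snd -` N \<in> null_sets (lborel :: ('a \<times> 'a) measure)"
    using vimage_fst_null_set[OF N(1)] vimage_snd_null_set[OF N(1)] by auto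
  then show ?thesis by (rule AE_I') (use N(2) in auto)
qed

lemma ex_borel_representative:
  fixes f :: "real^'n::finite \<Rightarrow> real^'n"
  assumes "f \<in> borel_measurable lebesgue"
  obtains g where "g \<in> borel_measurable borel" "AE x in lborel. f x = g x"
proof -
  have "\<exists>g. g \<in> borel_measurable lborel \<and> (AE x in lborel. f x $ i = g x)" for i
    using completion_ex_borel_measurable_real[of "\<lambda>x. f x $ i" lborel] assms by fastforce
  then obtain g where g: "g i \<in> borel_measurable lborel" "AE x in lborel. f x $ i = g i x" for i
    by metis
  show ?thesis
  proof
    show "(\<lambda>x. \<chi> i. g i x) \<in> borel_measurable borel"
      by (subst borel_measurable_euclidean_space) (use g(1) in \<open>auto simp: Basis_vec_def inner_axis\<close>)
    have "AE x in lborel. \<forall>i\<in>UNIV. f x $ i = g i x"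
      using g(2) by (subst AE_finite_all) auto
    then show "AE x in lborel. f x = (\<chi> i. g i x)"
      by eventually_elim (simp add: vec_eq_iff)
  qed
qed

lemma nn_integral_lebesgue_on:
  fixes f :: "'a::euclidean_space \<Rightarrow> ennreal"
  assumes "S \<in> sets lebesgue"
  shows "(\<integral>\<^sup>+x. f x \<partial>lebesgue_on S) = (\<integral>\<^sup>+x. f x * indicator S x \<partial>lborel)"
  using assms by (simp add: nn_integral_restrict_space nn_integral_completion)

section \<open>The nonlocal bilinear form\<close>

lemma semi_inner_L2:
  fixes \<Omega> :: "(real^'n::finite) set"
  shows "semi_inner (L2 \<Omega>) (L2_inner \<Omega>)"
proof
  fix u v w :: "real^'n \<Rightarrow> real^'n" and c :: real
  have int: "integrable (lebesgue_on \<Omega>) (\<lambda>x. f x \<bullet> g x)" if "f \<in> L2 \<Omega>" "g \<in> L2 \<Omega>" for f g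
  proof (rule Bochner_Integration.integrable_bound)
    show "integrable (lebesgue_on \<Omega>) (\<lambda>x. (norm (f x))\<^sup>2 + (norm (g x))\<^sup>2)"
      using that by (simp add: L2_def)
    show "(\<lambda>x. f x \<bullet> g x) \<in> borel_measurable (lebesgue_on \<Omega>)"
      using that by (auto simp: L2_def)
    have "norm (a \<bullet> b) \<le> norm ((norm a)\<^sup>2 + (norm b)\<^sup>2)" for a b :: "real^'n"
    proof -
      have "\<bar>a \<bullet> b\<bar> \<le> norm a * norm b" by (rule Cauchy_Schwarz_ineq2)
      also have "\<dots> \<le> (norm a)\<^sup>2 + (norm b)\<^sup>2"
        using sum_squares_bound[of "norm a" "norm b"] mult_nonneg_nonneg[OF norm_ge_zero[of a] norm_ge_zero[of b]]
        by linarith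
      finally show ?thesis by simp
    qed
    then show "AE x in lebesgue_on \<Omega>. norm (f x \<bullet> g x) \<le> norm ((norm (f x))\<^sup>2 + (norm (g x))\<^sup>2)"
      by simp
  qed
  assume u: "u \<in> L2 \<Omega>"
  show "0 \<le> L2_inner \<Omega> u u" by (simp add: L2_inner_def)
  assume v: "v \<in> L2 \<Omega>"
  show "L2_inner \<Omega> u v = L2_inner \<Omega> v u" by (simp add: L2_inner_def inner_commute)
  have eq: "(\<lambda>x. (norm (u x + c *\<^sub>R v x))\<^sup>2) = (\<lambda>x. u x \<bullet> u x + 2 * c * (u x \<bullet> v x) + c\<^sup>2 * (v x \<bullet> v x))"
    unfolding power2_norm_eq_inner
    by (simp add: fun_eq_iff inner_add_left inner_add_right inner_commute power2_eq_square algebra_simps)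
  have "integrable (lebesgue_on \<Omega>) (\<lambda>x. (norm (u x + c *\<^sub>R v x))\<^sup>2)"
    unfolding eq by (intro Bochner_Integration.integrable_add integrable_mult_right int u v)
  moreover have "(\<lambda>x. u x + c *\<^sub>R v x) \<in> borel_measurable (lebesgue_on \<Omega>)"
    using u v by (intro borel_measurable_add borel_measurable_scaleR) (auto simp: L2_def)
  ultimately show "(\<lambda>x. u x + c *\<^sub>R v x) \<in> L2 \<Omega>" by (simp add: L2_def)
  assume w: "w \<in> L2 \<Omega>"
  show "L2_inner \<Omega> (\<lambda>x. u x + c *\<^sub>R v x) w = L2_inner \<Omega> u w + c * L2_inner \<Omega> v w"
    using int[OF u w] int[OF v w] by (simp add: L2_inner_def inner_add_left)
qed

lemma L2_norm_eq: "L2_norm \<Omega> u = sqrt (L2_inner \<Omega> u u)"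
  by (simp add: L2_norm_def L2_inner_def power2_norm_eq_inner)

text \<open>
  Polarization of the seminorm: the integrand of the seminorm is the case of constant
  coefficient 1 and equal arguments, so that integrability and bilinearity need only be
  studied once.
\<close>

definition B_integrand where
  "B_integrand \<kappa> k u v = (\<lambda>(x, y). H_coef \<kappa> x y * k (norm (x - y))
     * (Dop u x y / norm (x - y)) * (Dop v x y / norm (x - y)))"

lemma B_form_eq: "B_form \<Omega> \<kappa> k \<delta> u v = 1/2 * (LINT z|lebesgue_on (D_dom \<Omega> \<delta>). B_integrand \<kappa> k u v z)"
  unfolding B_form_def B_integrand_def ..

lemma X_integrand_eq: "X_integrand k u = B_integrand (\<lambda>x. 1) k u u"
  unfolding X_integrand_def B_integrand_def H_coef_def
  by (auto simp: power2_eq_square abs_mult_self_eq)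

lemma Dop_lin: "Dop (\<lambda>x. u x + c *\<^sub>R v x) x y = Dop u x y + c * Dop v x y"
  by (simp add: Dop_def inner_diff_left inner_add_left algebra_simps)

lemma open_Omega_ext: "open \<Omega> \<Longrightarrow> open (Omega_ext \<Omega> \<delta>)"
  unfolding Omega_ext_def by (intro open_Un open_Collect_less continuous_intros) auto

lemma open_D_dom: "open \<Omega> \<Longrightarrow> open (D_dom \<Omega> \<delta>)"
  unfolding D_dom_def by (intro open_Un open_Times open_Omega_ext)

lemma Omega_subset_ext: "\<Omega> \<subseteq> Omega_ext \<Omega> \<delta>"
  by (auto simp: Omega_ext_def)

lemma D_dom_subset: "D_dom \<Omega> \<delta> \<subseteq> Omega_ext \<Omega> \<delta> \<times> Omega_ext \<Omega> \<delta>"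
  using Omega_subset_ext by (auto simp: D_dom_def)

lemma near_in_Omega_ext: "x \<in> \<Omega> \<Longrightarrow> norm (x - y) < \<delta> \<Longrightarrow> y \<in> Omega_ext \<Omega> \<delta>"
  using infdist_le[of x \<Omega> y] by (auto simp: Omega_ext_def dist_norm norm_minus_commute)

text \<open>
  One fixed horizon. The number \<open>d\<close> bounds the diameter of \<open>\<Omega>\<close>, and the profile \<open>k\<close> is a Borel
  function on the whole line; \<open>punctured\<close> below reduces general profiles to this case.
\<close>

locale nonlocal_kernel =
  fixes \<Omega> :: "(real^'n::finite) set" and k :: "real \<Rightarrow> real" and \<delta> d :: real
  assumes open_\<Omega>: "open \<Omega>"
    and diam: "\<And>x y. x \<in> \<Omega> \<Longrightarrow> y \<in> \<Omega> \<Longrightarrow> norm (x - y) \<le> d"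
    and d_nonneg: "0 \<le> d" and \<delta>_pos: "0 < \<delta>"
    and k_borel[measurable]: "k \<in> borel_measurable borel" and k_nonneg: "\<And>r. 0 \<le> k r"
    and k_supp: "\<And>r. \<delta> \<le> r \<Longrightarrow> k r = 0"
    and k_mass: "(\<integral>\<^sup>+\<xi>. ennreal (k (norm \<xi>)) \<partial>(lborel :: (real^'n) measure)) = 1"
begin

abbreviation "E \<equiv> Omega_ext \<Omega> \<delta>"
abbreviation "D \<equiv> D_dom \<Omega> \<delta>"

lemma sets_\<Omega>_E_D: "\<Omega> \<in> sets lebesgue" "E \<in> sets lebesgue" "D \<in> sets lebesgue"
  using open_\<Omega> open_Omega_ext[of \<Omega> \<delta>] open_D_dom[of \<Omega> \<delta>] by auto

lemma measurable_fst_snd_D: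
  "fst \<in> lebesgue_on D \<rightarrow>\<^sub>M lebesgue_on E" "snd \<in> lebesgue_on D \<rightarrow>\<^sub>M lebesgue_on E"
  using D_dom_subset[of \<Omega> \<delta>]
  by (auto intro!: measurable_restrict_space3 measurable_fst_lebesgue measurable_snd_lebesgue)

lemma space_DE:
  assumes "z \<in> space (lebesgue_on D)"
  obtains x y where "z = (x, y)" "x \<in> E" "y \<in> E"
proof -
  have "z \<in> E \<times> E" using assms D_dom_subset[of \<Omega> \<delta>] by (auto simp: space_restrict_space)
  then show ?thesis using that by blast
qed

lemma borel_measurable_D: "f \<in> borel_measurable borel \<Longrightarrow> f \<in> borel_measurable (lebesgue_on D)"
  by (intro measurable_restrict_space1 measurable_completion) simp

lemma B_integrand_measurable:
  assumes "\<kappa> \<in> borel_measurable (lebesgue_on E)" "u \<in> borel_measurable (lebesgue_on E)"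
    "v \<in> borel_measurable (lebesgue_on E)"
  shows "B_integrand \<kappa> k u v \<in> borel_measurable (lebesgue_on D)"
proof -
  have m: "(\<lambda>z. f (fst z)) \<in> borel_measurable (lebesgue_on D)" "(\<lambda>z. f (snd z)) \<in> borel_measurable (lebesgue_on D)"
    if "f \<in> borel_measurable (lebesgue_on E)" for f :: "real^'n \<Rightarrow> 'b::topological_space"
    using measurable_compose[OF measurable_fst_snd_D(1) that] measurable_compose[OF measurable_fst_snd_D(2) that] by auto
  note [measurable] = m[OF assms(1)] m[OF assms(2)] m[OF assms(3)]
  have diff[measurable]: "(\<lambda>z. fst z - snd z :: real^'n) \<in> borel_measurable (lebesgue_on D)"
    by (intro borel_measurable_D borel_measurable_continuous_onI continuous_intros)
  show ?thesis
    unfolding B_integrand_def H_coef_def Dop_def case_prod_beta by measurable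
qed

lemma B_integrand_bound:
  assumes \<kappa>: "\<And>x. x \<in> E \<Longrightarrow> 0 \<le> \<kappa> x \<and> \<kappa> x \<le> K" and z: "z \<in> D"
  shows "\<bar>B_integrand \<kappa> k u v z\<bar> \<le> K * (X_integrand k u z + X_integrand k v z)"
proof -
  obtain x y where xy: "z = (x, y)" "x \<in> E" "y \<in> E" using z D_dom_subset[of \<Omega> \<delta>] by blast
  let ?a = "Dop u x y / norm (x - y)" and ?b = "Dop v x y / norm (x - y)" and ?k = "k (norm (x - y))"
  have H: "0 \<le> H_coef \<kappa> x y" "H_coef \<kappa> x y \<le> K" using \<kappa>[OF xy(2)] \<kappa>[OF xy(3)] by (auto simp: H_coef_def)
  have "\<bar>?a * ?b\<bar> \<le> ?a\<^sup>2 + ?b\<^sup>2"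
    using sum_squares_bound[of "\<bar>?a\<bar>" "\<bar>?b\<bar>"] mult_nonneg_nonneg[OF abs_ge_zero[of ?a] abs_ge_zero[of ?b]]
    by (simp only: abs_mult power2_abs)
  then have "(H_coef \<kappa> x y * ?k) * \<bar>?a * ?b\<bar> \<le> (K * ?k) * (?a\<^sup>2 + ?b\<^sup>2)"
    using H k_nonneg[of "norm (x - y)"] by (intro mult_mono) auto
  moreover have "\<bar>B_integrand \<kappa> k u v z\<bar> = (H_coef \<kappa> x y * ?k) * \<bar>?a * ?b\<bar>"
    using H k_nonneg[of "norm (x - y)"] by (simp add: B_integrand_def xy abs_mult)
  moreover have "K * (X_integrand k u z + X_integrand k v z) = (K * ?k) * (?a\<^sup>2 + ?b\<^sup>2)"
    by (simp add: X_integrand_def xy power_divide algebra_simps)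
  ultimately show ?thesis by (simp only:)
qed

lemma X_space_measurable: "u \<in> X_space \<Omega> k \<delta> \<Longrightarrow> u \<in> borel_measurable (lebesgue_on E)"
  by (simp add: X_space_def)

lemma B_integrable:
  assumes \<kappa>m: "\<kappa> \<in> borel_measurable (lebesgue_on E)"
    and \<kappa>: "\<And>x. x \<in> E \<Longrightarrow> 0 \<le> \<kappa> x \<and> \<kappa> x \<le> K"
    and u: "u \<in> X_space \<Omega> k \<delta>" and v: "v \<in> X_space \<Omega> k \<delta>"
  shows "integrable (lebesgue_on D) (B_integrand \<kappa> k u v)"
proof (rule Bochner_Integration.integrable_bound)
  show "integrable (lebesgue_on D) (\<lambda>z. K * (X_integrand k u z + X_integrand k v z))"
    using u v by (simp add: X_space_def)
  show "B_integrand \<kappa> k u v \<in> borel_measurable (lebesgue_on D)"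
    using B_integrand_measurable \<kappa>m u v X_space_measurable by blast
  show "AE z in lebesgue_on D. norm (B_integrand \<kappa> k u v z) \<le> norm (K * (X_integrand k u z + X_integrand k v z))"
  proof (rule AE_I2)
    fix z assume "z \<in> space (lebesgue_on D)"
    then show "norm (B_integrand \<kappa> k u v z) \<le> norm (K * (X_integrand k u z + X_integrand k v z))"
      using B_integrand_bound[where \<kappa>=\<kappa>, OF \<kappa>, where z=z and u=u and v=v] by (simp add: space_restrict_space)
  qed
qed

lemma B_integrand_lin:
  "B_integrand \<kappa> k (\<lambda>x. u x + c *\<^sub>R v x) w z = B_integrand \<kappa> k u w z + c * B_integrand \<kappa> k v w z"
  unfolding B_integrand_def case_prod_beta Dop_lin by (simp add: add_divide_distrib algebra_simps)

lemma X_space_lin: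
  assumes u: "u \<in> X_space \<Omega> k \<delta>" and v: "v \<in> X_space \<Omega> k \<delta>"
  shows "(\<lambda>x. u x + c *\<^sub>R v x) \<in> X_space \<Omega> k \<delta>"
proof -
  let ?w = "\<lambda>x. u x + c *\<^sub>R v x"
  have comm: "B_integrand (\<lambda>x. 1) k f g z = B_integrand (\<lambda>x. 1) k g f z"
    for f g :: "real^'n \<Rightarrow> real^'n" and z
    by (simp add: B_integrand_def case_prod_beta mult_ac)
  have eq: "X_integrand k ?w = (\<lambda>z. B_integrand (\<lambda>x. 1) k u u z + c * B_integrand (\<lambda>x. 1) k u v z
      + c * (B_integrand (\<lambda>x. 1) k v u z + c * B_integrand (\<lambda>x. 1) k v v z))"
    unfolding X_integrand_eq
    by (rule ext) (simp only: B_integrand_lin comm[of _ "\<lambda>x. u x + c *\<^sub>R v x"], simp only: comm[of v u])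
  have int: "integrable (lebesgue_on D) (B_integrand (\<lambda>x. 1) k f g)"
    if "f \<in> X_space \<Omega> k \<delta>" "g \<in> X_space \<Omega> k \<delta>" for f g
    by (rule B_integrable[of _ 1]) (use that in auto)
  have "integrable (lebesgue_on D) (X_integrand k ?w)"
    unfolding eq by (intro Bochner_Integration.integrable_add integrable_mult_right int u v)
  moreover have "?w \<in> L2 \<Omega>"
    using semi_inner.closed[OF semi_inner_L2, of u \<Omega> v c] u v by (simp add: X_space_def)
  moreover have "?w \<in> borel_measurable (lebesgue_on E)"
    using X_space_measurable[OF u] X_space_measurable[OF v]
    by (intro borel_measurable_add borel_measurable_scaleR) auto
  ultimately show ?thesis by (simp add: X_space_def)
qed

lemma X0_space_lin:
  assumes u: "u \<in> X0_space \<Omega> k \<delta>" and v: "v \<in> X0_space \<Omega> k \<delta>"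
  shows "(\<lambda>x. u x + c *\<^sub>R v x) \<in> X0_space \<Omega> k \<delta>"
proof -
  have "AE x in lebesgue_on (E - \<Omega>). u x = 0" "AE x in lebesgue_on (E - \<Omega>). v x = 0"
    using u v by (auto simp: X0_space_def)
  then have "AE x in lebesgue_on (E - \<Omega>). u x + c *\<^sub>R v x = 0" by eventually_elim simp
  then show ?thesis using X_space_lin u v by (auto simp: X0_space_def)
qed

lemma semi_inner_B_form:
  assumes \<kappa>m: "\<kappa> \<in> borel_measurable (lebesgue_on E)"
    and \<kappa>: "\<And>x. x \<in> E \<Longrightarrow> 0 \<le> \<kappa> x \<and> \<kappa> x \<le> K"
  shows "semi_inner (X0_space \<Omega> k \<delta>) (B_form \<Omega> \<kappa> k \<delta>)"
proof
  fix u v w :: "real^'n \<Rightarrow> real^'n" and c :: real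
  note int = B_integrable[OF \<kappa>m \<kappa>]
  show "(\<lambda>x. u x + c *\<^sub>R v x) \<in> X0_space \<Omega> k \<delta>" if "u \<in> X0_space \<Omega> k \<delta>" "v \<in> X0_space \<Omega> k \<delta>"
    using X0_space_lin that .
  have "B_integrand \<kappa> k u v = B_integrand \<kappa> k v u"
    by (auto simp: B_integrand_def case_prod_beta mult_ac)
  then show "B_form \<Omega> \<kappa> k \<delta> u v = B_form \<Omega> \<kappa> k \<delta> v u" by (simp add: B_form_eq)
  have "0 \<le> (LINT z|lebesgue_on D. B_integrand \<kappa> k u u z)"
  proof (rule integral_nonneg_AE, rule AE_I2)
    fix z assume "z \<in> space (lebesgue_on D)"
    then obtain x y where "z = (x, y)" "x \<in> E" "y \<in> E"
      by (rule space_DE)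
    then show "0 \<le> B_integrand \<kappa> k u u z"
      using \<kappa>[of x] \<kappa>[of y] k_nonneg[of "norm (x - y)"]
      by (simp add: B_integrand_def H_coef_def mult.assoc)
  qed
  then show "0 \<le> B_form \<Omega> \<kappa> k \<delta> u u" by (simp add: B_form_eq)
  assume "u \<in> X0_space \<Omega> k \<delta>" "v \<in> X0_space \<Omega> k \<delta>" "w \<in> X0_space \<Omega> k \<delta>"
  then have "u \<in> X_space \<Omega> k \<delta>" "v \<in> X_space \<Omega> k \<delta>" "w \<in> X_space \<Omega> k \<delta>"
    by (auto simp: X0_space_def)
  then show "B_form \<Omega> \<kappa> k \<delta> (\<lambda>x. u x + c *\<^sub>R v x) w = B_form \<Omega> \<kappa> k \<delta> u w + c * B_form \<Omega> \<kappa> k \<delta> v w"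
    using int[of u w] int[of v w] by (simp add: B_form_eq B_integrand_lin algebra_simps)
qed

lemma X_seminorm_eq: "(X_seminorm \<Omega> k \<delta> u)\<^sup>2 = 2 * B_form \<Omega> (\<lambda>x. 1) k \<delta> u u"
proof -
  have "0 \<le> (LINT z|lebesgue_on D. X_integrand k u z)"
    by (intro integral_nonneg_AE AE_I2 X_integrand_nonneg k_nonneg)
  then show ?thesis unfolding X_seminorm_def B_form_eq by (simp flip: X_integrand_eq)
qed

lemma B_form_mono:
  assumes \<kappa>m: "\<kappa> \<in> borel_measurable (lebesgue_on E)" "\<kappa>' \<in> borel_measurable (lebesgue_on E)"
    and \<kappa>: "\<And>x. x \<in> E \<Longrightarrow> 0 \<le> \<kappa> x \<and> \<kappa> x \<le> \<kappa>' x \<and> \<kappa>' x \<le> K"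
    and u: "u \<in> X_space \<Omega> k \<delta>"
  shows "B_form \<Omega> \<kappa> k \<delta> u u \<le> B_form \<Omega> \<kappa>' k \<delta> u u"
proof -
  have "(LINT z|lebesgue_on D. B_integrand \<kappa> k u u z) \<le> (LINT z|lebesgue_on D. B_integrand \<kappa>' k u u z)"
  proof (rule integral_mono)
    show "integrable (lebesgue_on D) (B_integrand \<kappa> k u u)"
      by (rule B_integrable[OF \<kappa>m(1) _ u u, of K]) (use \<kappa> in force)
    show "integrable (lebesgue_on D) (B_integrand \<kappa>' k u u)"
      by (rule B_integrable[OF \<kappa>m(2) _ u u, of K]) (use \<kappa> in force)
    fix z assume "z \<in> space (lebesgue_on D)"
    then obtain x y where z: "z = (x, y)" "x \<in> E" "y \<in> E"
      by (rule space_DE)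
    have "H_coef \<kappa> x y \<le> H_coef \<kappa>' x y"
      using \<kappa>[OF z(2)] \<kappa>[OF z(3)] by (simp add: H_coef_def)
    then show "B_integrand \<kappa> k u u z \<le> B_integrand \<kappa>' k u u z"
      unfolding B_integrand_def z(1) mult.assoc prod.case
      by (rule mult_right_mono) (simp add: k_nonneg)
  qed
  then show ?thesis by (simp add: B_form_eq)
qed

lemma B_form_const: "B_form \<Omega> (\<lambda>x. c) k \<delta> u v = c * B_form \<Omega> (\<lambda>x. 1) k \<delta> u v"
proof -
  have "B_integrand (\<lambda>x. c) k u v = (\<lambda>z. c * B_integrand (\<lambda>x. 1) k u v z)"
    by (auto simp: B_integrand_def H_coef_def)
  then show ?thesis by (simp add: B_form_eq)
qed

section \<open>The Poincare-Korn inequality on the energy space\<close>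

text \<open>
  The iterated integrals of the Poincare-Korn inequality require a Borel function that vanishes
  everywhere outside \<open>\<Omega>\<close>, not only almost everywhere in the collar.
\<close>

lemma X0_borel_representative:
  assumes u: "u \<in> X0_space \<Omega> k \<delta>"
  obtains U where "U \<in> borel_measurable borel" "\<And>x. x \<notin> \<Omega> \<Longrightarrow> U x = 0"
    "AE x in lborel. x \<in> E \<longrightarrow> u x = U x"
proof -
  have "u \<in> borel_measurable (lebesgue_on \<Omega>)"
    using u by (simp add: X0_space_def X_space_def L2_def)
  then have "(\<lambda>x. if x \<in> \<Omega> then u x else 0) \<in> borel_measurable lebesgue"
    using borel_measurable_if[OF sets_\<Omega>_E_D(1)] by blast
  then obtain g where g: "g \<in> borel_measurable borel" "AE x in lborel. (if x \<in> \<Omega> then u x else 0) = g x"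
    by (rule ex_borel_representative)
  have "AE x in lebesgue_on (E - \<Omega>). u x = 0" using u by (simp add: X0_space_def)
  then have zero: "AE x in lborel. x \<in> E - \<Omega> \<longrightarrow> u x = 0"
    using sets_\<Omega>_E_D by (simp add: AE_restrict_space_iff AE_completion_iff)
  show ?thesis
  proof
    have "\<Omega> \<in> sets borel" using open_\<Omega> by simp
    then show "(\<lambda>x. indicat_real \<Omega> x *\<^sub>R g x) \<in> borel_measurable borel" using g(1) by simp
    show "AE x in lborel. x \<in> E \<longrightarrow> u x = indicat_real \<Omega> x *\<^sub>R g x"
      using g(2) zero by eventually_elim (auto simp: indicator_def split: if_splits)
  qed simp
qed

text \<open>
  Pairs outside the domain of integration either both lie outside \<open>\<Omega>\<close>, where \<open>U\<close> vanishes, or are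
  too far apart for the kernel. Hence the seminorm may be computed over the whole product space.
\<close>

lemma X_integrand_off_D:
  assumes zero: "\<And>x. x \<notin> \<Omega> \<Longrightarrow> U x = 0" and z: "z \<notin> D"
  shows "X_integrand k U z = 0"
proof -
  obtain x y where xy: "z = (x, y)" by fastforce
  show ?thesis
  proof (cases "norm (x - y) < \<delta>")
    case True
    then have "x \<notin> \<Omega>" "y \<notin> \<Omega>"
      using near_in_Omega_ext[of x \<Omega> y \<delta>] near_in_Omega_ext[of y \<Omega> x \<delta>] z xy
      by (auto simp: D_dom_def norm_minus_commute)
    then show ?thesis by (simp add: X_integrand_def Dop_def xy zero)
  next
    case False
    then show ?thesis using k_supp[of "norm (x - y)"] by (simp add: X_integrand_def xy)
  qed
qed

lemma Poincare_Korn_X0: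
  assumes u: "u \<in> X0_space \<Omega> k \<delta>"
  shows "L2_inner \<Omega> u u \<le> CARD('n) * (d + \<delta>)\<^sup>2 * (2 * B_form \<Omega> (\<lambda>x. 1) k \<delta> u u)"
proof -
  obtain U where U: "U \<in> borel_measurable borel" "\<And>x. x \<notin> \<Omega> \<Longrightarrow> U x = 0"
    and uU: "AE x in lborel. x \<in> E \<longrightarrow> u x = U x"
    using X0_borel_representative[OF u] by blast
  have uX: "integrable (lebesgue_on \<Omega>) (\<lambda>x. (norm (u x))\<^sup>2)" "integrable (lebesgue_on D) (X_integrand k u)"
    using u by (auto simp: X0_space_def X_space_def L2_def)
  have "ennreal (L2_inner \<Omega> u u) = (\<integral>\<^sup>+x. ennreal ((norm (u x))\<^sup>2) \<partial>lebesgue_on \<Omega>)"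
    using nn_integral_eq_integral[OF uX(1)] by (simp add: L2_inner_def power2_norm_eq_inner)
  also have "\<dots> = (\<integral>\<^sup>+x. ennreal ((norm (u x))\<^sup>2) * indicator \<Omega> x \<partial>lborel)"
    by (rule nn_integral_lebesgue_on[OF sets_\<Omega>_E_D(1)])
  also have "\<dots> = (\<integral>\<^sup>+x. ennreal ((norm (U x))\<^sup>2) \<partial>lborel)"
  proof (rule nn_integral_cong_AE)
    show "AE x in lborel. ennreal ((norm (u x))\<^sup>2) * indicator \<Omega> x = ennreal ((norm (U x))\<^sup>2)"
      using uU by eventually_elim (use U(2) Omega_subset_ext[of \<Omega> \<delta>] in \<open>auto split: split_indicator\<close>)
  qed
  finally have L: "ennreal (L2_inner \<Omega> u u) = (\<integral>\<^sup>+x. ennreal ((norm (U x))\<^sup>2) \<partial>lborel)" .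
  have "ennreal (2 * B_form \<Omega> (\<lambda>x. 1) k \<delta> u u) = ennreal (LINT z|lebesgue_on D. X_integrand k u z)"
    by (simp add: B_form_eq X_integrand_eq)
  also have "\<dots> = (\<integral>\<^sup>+z. ennreal (X_integrand k u z) \<partial>lebesgue_on D)"
    by (rule nn_integral_eq_integral[OF uX(2), symmetric]) (simp add: X_integrand_nonneg k_nonneg)
  also have "\<dots> = (\<integral>\<^sup>+z. ennreal (X_integrand k u z) * indicator D z \<partial>lborel)"
    by (rule nn_integral_lebesgue_on[OF sets_\<Omega>_E_D(3)])
  also have "\<dots> = (\<integral>\<^sup>+z. ennreal (X_integrand k U z) \<partial>lborel)"
  proof (rule nn_integral_cong_AE)
    show "AE z in lborel. ennreal (X_integrand k u z) * indicator D z = ennreal (X_integrand k U z)"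
      using AE_fst_snd[OF uU]
    proof eventually_elim
      fix z assume *: "(fst z \<in> E \<longrightarrow> u (fst z) = U (fst z)) \<and> (snd z \<in> E \<longrightarrow> u (snd z) = U (snd z))"
      show "ennreal (X_integrand k u z) * indicator D z = ennreal (X_integrand k U z)"
      proof (cases "z \<in> D")
        case True
        then have "z \<in> E \<times> E" using D_dom_subset[of \<Omega> \<delta>] by blast
        then have "X_integrand k u z = X_integrand k U z"
          using * by (auto simp: X_integrand_def Dop_def)
        then show ?thesis using True by simp
      next
        case False
        then show ?thesis using X_integrand_off_D[OF U(2) False] by simp
      qed
    qed
  qed
  finally have S: "ennreal (2 * B_form \<Omega> (\<lambda>x. 1) k \<delta> u u) = (\<integral>\<^sup>+z. ennreal (X_integrand k U z) \<partial>lborel)" .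
  have B0: "0 \<le> 2 * B_form \<Omega> (\<lambda>x. 1) k \<delta> u u"
    unfolding X_seminorm_eq[symmetric] by simp
  have "ennreal (L2_inner \<Omega> u u)
      \<le> ennreal (CARD('n) * (d + \<delta>)\<^sup>2) * ennreal (2 * B_form \<Omega> (\<lambda>x. 1) k \<delta> u u)"
    using Poincare_Korn[OF k_borel k_nonneg k_supp k_mass U diam d_nonneg \<delta>_pos]
    unfolding L S lborel_prod .
  also have "\<dots> = ennreal (CARD('n) * (d + \<delta>)\<^sup>2 * (2 * B_form \<Omega> (\<lambda>x. 1) k \<delta> u u))"
    by (rule ennreal_mult'[symmetric]) simp
  finally show ?thesis using B0 by (simp add: ennreal_le_iff)
qed

section \<open>Finite element functions have finite energy\<close>

lemma bounded_\<Omega>: "bounded \<Omega>"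
proof (cases "\<Omega> = {}")
  case False
  then obtain x where "x \<in> \<Omega>" by blast
  then have "\<Omega> \<subseteq> cball x d" using diam by (auto simp: dist_norm)
  then show ?thesis using bounded_cball bounded_subset by blast
qed simp

lemma nn_integral_kernel_D_finite:
  "(\<integral>\<^sup>+z. ennreal (k (norm (fst z - snd z))) * indicator D z \<partial>lborel) < \<infinity>"
proof -
  have [measurable]: "\<Omega> \<in> sets borel" using open_\<Omega> by simp
  have shift: "(\<integral>\<^sup>+y. ennreal (k (norm (y - x))) \<partial>lborel) = 1" for x :: "real^'n"
    using nn_integral_lborel_translate[of "\<lambda>y. ennreal (k (norm y))" "- x"] k_mass by simp
  let ?f = "\<lambda>z::(real^'n) \<times> (real^'n). ennreal (k (norm (fst z - snd z)))"
  have "(\<integral>\<^sup>+z. ?f z * indicator D z \<partial>lborel)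
      \<le> (\<integral>\<^sup>+z. ?f z * indicator \<Omega> (fst z) + ?f z * indicator \<Omega> (snd z) \<partial>(lborel \<Otimes>\<^sub>M lborel))"
    unfolding lborel_prod by (rule nn_integral_mono) (auto simp: D_dom_def split: split_indicator)
  also have "\<dots> = (\<integral>\<^sup>+z. ?f z * indicator \<Omega> (fst z) \<partial>(lborel \<Otimes>\<^sub>M lborel))
      + (\<integral>\<^sup>+z. ?f z * indicator \<Omega> (snd z) \<partial>(lborel \<Otimes>\<^sub>M lborel))"
    by (rule nn_integral_add) measurable
  also have "(\<integral>\<^sup>+z. ?f z * indicator \<Omega> (fst z) \<partial>(lborel \<Otimes>\<^sub>M lborel))
      = (\<integral>\<^sup>+x. \<integral>\<^sup>+y. ennreal (k (norm (y - x))) * indicator \<Omega> x \<partial>lborel \<partial>lborel)"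
    by (subst lborel.nn_integral_fst[symmetric], measurable) (simp add: norm_minus_commute)
  also have "\<dots> = emeasure lborel \<Omega>"
    by (simp add: nn_integral_multc shift)
  also have "(\<integral>\<^sup>+z. ?f z * indicator \<Omega> (snd z) \<partial>(lborel \<Otimes>\<^sub>M lborel))
      = (\<integral>\<^sup>+y. \<integral>\<^sup>+x. ennreal (k (norm (x - y))) * indicator \<Omega> y \<partial>lborel \<partial>lborel)"
    by (subst lborel_pair.nn_integral_snd[symmetric]) measurable
  also have "\<dots> = emeasure lborel \<Omega>"
    by (simp add: nn_integral_multc shift)
  also have "emeasure lborel \<Omega> + emeasure lborel \<Omega> < \<infinity>"
    using emeasure_bounded_finite[OF bounded_\<Omega>] by (simp add: less_top)
  finally show ?thesis by (simp add: less_top)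
qed

text \<open>
  A Lipschitz bound for pairs at distance less than \<open>\<delta>\<close> cancels the singular weight and leaves a
  multiple of the kernel, whose integral over the domain is at most twice the volume of \<open>\<Omega>\<close>.
\<close>

lemma X_space_if_lipschitz_near:
  assumes um: "u \<in> borel_measurable (lebesgue_on E)" and uL2: "u \<in> L2 \<Omega>"
    and lip: "\<And>x y. x \<in> \<Omega> \<Longrightarrow> norm (x - y) < \<delta> \<Longrightarrow> norm (u x - u y) \<le> M * norm (x - y)" and M: "0 \<le> M"
  shows "u \<in> X_space \<Omega> k \<delta>"
proof -
  have le: "X_integrand k u z \<le> M\<^sup>2 * k (norm (fst z - snd z))" if "z \<in> D" for z
  proof -
    obtain x y where z: "z = (x, y)" by fastforce
    have xy: "x \<in> \<Omega> \<or> y \<in> \<Omega>" using that by (auto simp: z D_dom_def)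
    show ?thesis
    proof (cases "norm (x - y) < \<delta> \<and> x \<noteq> y")
      case True
      have "norm (u x - u y) \<le> M * norm (x - y)"
        using xy lip[of x y] lip[of y x] True by (auto simp: norm_minus_commute)
      moreover have "\<bar>Dop u x y\<bar> \<le> norm (u x - u y) * norm ((x - y) /\<^sub>R norm (x - y))"
        unfolding Dop_def by (rule Cauchy_Schwarz_ineq2)
      ultimately have "\<bar>Dop u x y\<bar> \<le> M * norm (x - y)" using True by simp
      then have "\<bar>Dop u x y\<bar>\<^sup>2 / (norm (x - y))\<^sup>2 \<le> M\<^sup>2"
        using power_mono[of "\<bar>Dop u x y\<bar>" "M * norm (x - y)" 2] True
        by (simp add: field_simps power_mult_distrib)
      then have "k (norm (x - y)) * (\<bar>Dop u x y\<bar>\<^sup>2 / (norm (x - y))\<^sup>2) \<le> k (norm (x - y)) * M\<^sup>2"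
        by (rule mult_left_mono) (rule k_nonneg)
      then show ?thesis by (simp add: X_integrand_def z mult.commute)
    next
      case False
      then show ?thesis using k_supp[of "norm (x - y)"] k_nonneg[of 0] by (auto simp: X_integrand_def z)
    qed
  qed
  have "integrable (lebesgue_on D) (X_integrand k u)"
  proof (rule integrableI_bounded)
    show "X_integrand k u \<in> borel_measurable (lebesgue_on D)"
      unfolding X_integrand_eq by (rule B_integrand_measurable[OF _ um um]) simp
    have "(\<integral>\<^sup>+z. ennreal (norm (X_integrand k u z)) \<partial>lebesgue_on D)
        = (\<integral>\<^sup>+z. ennreal (norm (X_integrand k u z)) * indicator D z \<partial>lborel)"
      by (rule nn_integral_lebesgue_on[OF sets_\<Omega>_E_D(3)])
    also have "\<dots> \<le> (\<integral>\<^sup>+z. ennreal (M\<^sup>2) * (ennreal (k (norm (fst z - snd z))) * indicator D z) \<partial>lborel)"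
    proof (rule nn_integral_mono)
      fix z
      show "ennreal (norm (X_integrand k u z)) * indicator D z
          \<le> ennreal (M\<^sup>2) * (ennreal (k (norm (fst z - snd z))) * indicator D z)"
        using ennreal_leI[OF le[of z]] X_integrand_nonneg[of k z u, OF k_nonneg]
        by (simp add: ennreal_mult' k_nonneg split: split_indicator)
    qed
    also have "\<dots> = ennreal (M\<^sup>2) * (\<integral>\<^sup>+z. ennreal (k (norm (fst z - snd z))) * indicator D z \<partial>lborel)"
    proof (rule nn_integral_cmult)
      have "D \<in> sets borel" using open_D_dom[OF open_\<Omega>] by simp
      moreover have "(\<lambda>z::(real^'n) \<times> (real^'n). fst z - snd z) \<in> borel_measurable borel"
        by (intro borel_measurable_continuous_onI continuous_intros)
      ultimately show "(\<lambda>z. ennreal (k (norm (fst z - snd z))) * indicator D z) \<in> borel_measurable lborel"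
        by measurable
    qed
    also have "\<dots> < \<infinity>"
      using nn_integral_kernel_D_finite by (simp add: ennreal_mult_less_top)
    finally show "(\<integral>\<^sup>+z. ennreal (norm (X_integrand k u z)) \<partial>lebesgue_on D) < \<infinity>" .
  qed
  then show ?thesis using um uL2 by (simp add: X_space_def)
qed

text \<open>
  The neighbourhood of \<open>\<Omega>\<close> need not be convex, so a finite element function need not be Lipschitz on
  it with the constants of its affine pieces. But a point of \<open>\<Omega>\<close> and a point at distance less than
  \<open>\<delta>\<close> are joined by a segment inside the neighbourhood, which the mesh cuts into finitely many
  closed pieces, on each of which the function is affine.
\<close>

lemma Xh_subset_X0:
  assumes fin: "finite \<T>" and closed: "\<And>K. K \<in> \<T> \<Longrightarrow> closed K" and cover: "closure E \<subseteq> \<Union>\<T>"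
  shows "Xh_space \<Omega> \<delta> \<T> \<subseteq> X0_space \<Omega> k \<delta>"
proof
  fix u assume u: "u \<in> Xh_space \<Omega> \<delta> \<T>"
  then have cont: "continuous_on (closure E) u" and zero: "\<And>x. x \<in> E - \<Omega> \<Longrightarrow> u x = 0"
    and aff: "\<And>K. K \<in> \<T> \<Longrightarrow> \<exists>A c. linear A \<and> (\<forall>x \<in> K \<inter> closure E. u x = A x + c)"
    by (auto simp: Xh_space_def)
  have sub: "E \<subseteq> closure E" "closure \<Omega> \<subseteq> closure E"
    by (rule closure_subset, rule closure_mono[OF Omega_subset_ext])
  have um: "u \<in> borel_measurable (lebesgue_on E)" "u \<in> borel_measurable (lebesgue_on \<Omega>)"
    using sub closure_subset[of \<Omega>] sets_\<Omega>_E_D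
    by (auto intro!: continuous_imp_measurable_on_sets_lebesgue continuous_on_subset[OF cont])
  have "compact (u ` closure \<Omega>)"
    using bounded_\<Omega> by (intro compact_continuous_image continuous_on_subset[OF cont sub(2)]) simp
  then obtain R where R: "\<And>x. x \<in> closure \<Omega> \<Longrightarrow> norm (u x) \<le> R"
    using compact_imp_bounded bounded_iff by (metis imageI)
  have uL2: "u \<in> L2 \<Omega>"
  proof -
    interpret finite_measure "lebesgue_on \<Omega>"
      using bounded_\<Omega> open_\<Omega> by (intro finite_measure_lebesgue_on lmeasurable_open)
    have "integrable (lebesgue_on \<Omega>) (\<lambda>x. (norm (u x))\<^sup>2)"
    proof (rule integrable_const_bound)
      show "AE x in lebesgue_on \<Omega>. norm ((norm (u x))\<^sup>2) \<le> R\<^sup>2"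
        using R closure_subset[of \<Omega>]
        by (intro AE_I2) (auto simp: space_restrict_space intro!: power_mono)
      show "(\<lambda>x. (norm (u x))\<^sup>2) \<in> borel_measurable (lebesgue_on \<Omega>)" using um(2) by simp
    qed
    then show ?thesis using um by (simp add: L2_def)
  qed
  have "\<exists>L. 0 \<le> L \<and> (\<forall>x \<in> K \<inter> closure E. \<forall>y \<in> K \<inter> closure E. norm (u x - u y) \<le> L * norm (x - y))"
    if K: "K \<in> \<T>" for K
  proof -
    obtain A c where A: "linear A" "\<And>x. x \<in> K \<inter> closure E \<Longrightarrow> u x = A x + c" using aff[OF K] by blast
    obtain B where B: "B > 0" "\<And>x. norm (A x) \<le> B * norm x" using linear_bounded_pos[OF A(1)] by blast
    show ?thesis
    proof (intro exI[of _ B] conjI ballI)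
      fix x y assume "x \<in> K \<inter> closure E" "y \<in> K \<inter> closure E"
      then have "u x - u y = A (x - y)" using A by (simp add: linear_diff)
      then show "norm (u x - u y) \<le> B * norm (x - y)" using B(2) by simp
    qed (use B(1) in simp)
  qed
  then obtain L where L: "\<And>K. K \<in> \<T> \<Longrightarrow> 0 \<le> L K"
    "\<And>K x y. K \<in> \<T> \<Longrightarrow> x \<in> K \<inter> closure E \<Longrightarrow> y \<in> K \<inter> closure E \<Longrightarrow> norm (u x - u y) \<le> L K * norm (x - y)"
    by metis
  \<comment> \<open>Any common upper bound of the finitely many constants will do, and a sum is one even if the
    mesh is empty.\<close>
  define M where "M = (\<Sum>K\<in>\<T>. L K)"
  have M0: "0 \<le> M" unfolding M_def using L(1) by (rule sum_nonneg)
  have LM: "L K \<le> M" if "K \<in> \<T>" for K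
    unfolding M_def using that L(1) fin by (intro member_le_sum) auto
  have "norm (u x - u y) \<le> M * norm (x - y)" if x: "x \<in> \<Omega>" and near: "norm (x - y) < \<delta>" for x y
  proof -
    let ?p = "\<lambda>t::real. x + t *\<^sub>R (y - x)"
    let ?T = "\<lambda>K. {t \<in> {0..1}. ?p t \<in> K}"
    have pE: "?p t \<in> closure E" if "t \<in> {0..1}" for t
    proof -
      have "norm (x - ?p t) = t * norm (x - y)" using that by (simp add: norm_minus_commute)
      also have "\<dots> \<le> norm (x - y)" using that by (simp add: mult_left_le_one_le)
      finally show ?thesis using near_in_Omega_ext[OF x, of "?p t" \<delta>] near sub by auto
    qed
    have "(M * norm (x - y))-lipschitz_on {0..1} (\<lambda>t. u (?p t))"
    proof (rule lipschitz_on_closed_Union[OF _ _ fin])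
      fix K assume K: "K \<in> \<T>"
      show "closed (?T K)"
      proof -
        have "closed ({0..1} \<inter> ?p -` K)"
          using closed[OF K] by (intro closed_Int closed_vimage continuous_intros) auto
        moreover have "?T K = {0..1} \<inter> ?p -` K" by auto
        ultimately show ?thesis by simp
      qed
      show "(M * norm (x - y))-lipschitz_on (?T K) (\<lambda>t. u (?p t))"
      proof (rule lipschitz_onI)
        fix s t assume st: "s \<in> ?T K" "t \<in> ?T K"
        then have "norm (u (?p s) - u (?p t)) \<le> L K * norm (?p s - ?p t)"
          using L(2)[OF K] pE by blast
        also have "?p s - ?p t = (s - t) *\<^sub>R (y - x)" by (simp add: algebra_simps)
        also have "L K * norm ((s - t) *\<^sub>R (y - x)) \<le> M * norm ((s - t) *\<^sub>R (y - x))"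
          using LM[OF K] by (rule mult_right_mono) simp
        also have "\<dots> = M * norm (x - y) * dist s t" by (simp add: dist_norm norm_minus_commute)
        finally show "dist (u (?p s)) (u (?p t)) \<le> M * norm (x - y) * dist s t" by (simp add: dist_norm)
      qed (use M0 in simp)
    next
      show "{0..1} \<subseteq> (\<Union>K\<in>\<T>. ?T K)" using pE cover by blast
    qed (use M0 in simp)
    from lipschitz_onD[OF this, of 0 1] show ?thesis by (simp add: dist_norm)
  qed
  then have "u \<in> X_space \<Omega> k \<delta>" using X_space_if_lipschitz_near um(1) uL2 M0 by blast
  moreover have "AE x in lebesgue_on (E - \<Omega>). u x = 0"
    using zero by (intro AE_I2) (simp add: space_restrict_space)
  ultimately show "u \<in> X0_space \<Omega> k \<delta>" by (simp add: X0_space_def)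
qed

end

lemma zero_in_Xh: "(\<lambda>x. 0) \<in> Xh_space \<Omega> \<delta> \<T>"
proof -
  have "linear (\<lambda>x::real^'n. 0 :: real^'n)" by (simp add: linear_iff)
  then show ?thesis
    unfolding Xh_space_def by (intro CollectI conjI ballI exI[of _ "\<lambda>x. 0"] exI[of _ 0]) auto
qed

lemma Xh_diff:
  assumes u: "u \<in> Xh_space \<Omega> \<delta> \<T>" and v: "v \<in> Xh_space \<Omega> \<delta> \<T>"
  shows "(\<lambda>x. u x - v x) \<in> Xh_space \<Omega> \<delta> \<T>"
proof -
  have "\<exists>A c. linear A \<and> (\<forall>x \<in> K \<inter> closure (Omega_ext \<Omega> \<delta>). u x - v x = A x + c)" if K: "K \<in> \<T>" for K
  proof -
    have "\<exists>A c. linear A \<and> (\<forall>x \<in> K \<inter> closure (Omega_ext \<Omega> \<delta>). w x = A x + c)"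
      if "w \<in> Xh_space \<Omega> \<delta> \<T>" for w
      using that K by (simp add: Xh_space_def)
    from this[OF u] this[OF v] obtain A c A' c'
      where "linear A" "\<forall>x \<in> K \<inter> closure (Omega_ext \<Omega> \<delta>). u x = A x + c"
        "linear A'" "\<forall>x \<in> K \<inter> closure (Omega_ext \<Omega> \<delta>). v x = A' x + c'"
      by auto
    then show ?thesis
      by (intro exI[of _ "\<lambda>x. A x - A' x"] exI[of _ "c - c'"]) (auto intro: linear_compose_sub)
  qed
  then show ?thesis using u v unfolding Xh_space_def by (auto intro: continuous_on_diff)
qed

lemma mesh_elements:
  assumes "mesh U h \<T>"
  shows "finite \<T>" "\<And>K. K \<in> \<T> \<Longrightarrow> closed K" "closure U \<subseteq> \<Union>\<T>"
  using assms by (auto simp: mesh_def intro: closed_simplex)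

section \<open>Uniform coercivity and boundedness\<close>

context nonlocal_kernel
begin

lemma X_norm_eq:
  "X_norm \<Omega> k \<delta> u = sqrt (L2_inner \<Omega> u u + 2 * B_form \<Omega> (\<lambda>x. 1) k \<delta> u u)"
proof -
  have "0 \<le> L2_inner \<Omega> u u" by (simp add: L2_inner_def)
  then show ?thesis by (simp add: X_norm_def X_seminorm_eq L2_norm_eq)
qed

text \<open>
  The two constants depend on the horizon only through the bound \<open>\<delta>_max\<close>. Coercivity combines the
  Poincare-Korn inequality with the lower bound of the coefficient; boundedness is immediate from
  the upper bound.
\<close>

lemma control_setting_X0:
  fixes \<kappa> :: "real^'n \<Rightarrow> real" and \<kappa>_min \<kappa>_max \<delta>_max :: real
  assumes \<kappa>m: "\<kappa> \<in> borel_measurable (lebesgue_on E)" and \<kappa>_min: "0 < \<kappa>_min"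
    and \<kappa>: "\<And>x. x \<in> E \<Longrightarrow> \<kappa>_min \<le> \<kappa> x \<and> \<kappa> x \<le> \<kappa>_max" and "0 \<le> \<kappa>_max"
    and S: "finite \<T>" "\<And>K. K \<in> \<T> \<Longrightarrow> closed K" "closure E \<subseteq> \<Union>\<T>"
    and \<delta>_max: "\<delta> \<le> \<delta>_max"
  shows "control_setting (L2 \<Omega>) (X0_space \<Omega> k \<delta>) (Xh_space \<Omega> \<delta> \<T>) (L2_inner \<Omega>) (B_form \<Omega> \<kappa> k \<delta>)
    (\<lambda>u v. L2_inner \<Omega> u v + 2 * B_form \<Omega> (\<lambda>x. 1) k \<delta> u v)
    (sqrt (2 * (1 + CARD('n) * (d + \<delta>_max)\<^sup>2) / \<kappa>_min)) (sqrt (\<kappa>_max / 2))"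
proof (rule control_setting.intro)
  let ?V = "X0_space \<Omega> k \<delta>" and ?B1 = "B_form \<Omega> (\<lambda>x. 1) k \<delta>"
  let ?P = "CARD('n) * (d + \<delta>_max)\<^sup>2"
  show "semi_inner (L2 \<Omega>) (L2_inner \<Omega>)" by (rule semi_inner_L2)
  show "semi_inner ?V (B_form \<Omega> \<kappa> k \<delta>)"
    by (rule semi_inner_B_form[OF \<kappa>m, of \<kappa>_max]) (use \<kappa> \<kappa>_min in force)
  have B1: "semi_inner ?V ?B1" by (rule semi_inner_B_form[of _ 1]) auto
  show VL2: "?V \<subseteq> L2 \<Omega>" by (auto simp: X0_space_def X_space_def)
  have "semi_inner ?V (L2_inner \<Omega>)" using semi_inner_subset[OF semi_inner_L2 VL2] X0_space_lin .
  then show "semi_inner ?V (\<lambda>u v. L2_inner \<Omega> u v + 2 * ?B1 u v)"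
    using B1 by (rule semi_inner_add) simp
  show "Xh_space \<Omega> \<delta> \<T> \<subseteq> ?V" using S by (rule Xh_subset_X0)
  show "(\<lambda>x. u x - v x) \<in> Xh_space \<Omega> \<delta> \<T>" if "u \<in> Xh_space \<Omega> \<delta> \<T>" "v \<in> Xh_space \<Omega> \<delta> \<T>" for u v
    using that by (rule Xh_diff)
  fix u assume u: "u \<in> ?V"
  then have uX: "u \<in> X_space \<Omega> k \<delta>" by (simp add: X0_space_def)
  have B1u: "0 \<le> ?B1 u u" using semi_inner.nonneg[OF B1 u] .
  then show "L2_inner \<Omega> u u \<le> L2_inner \<Omega> u u + 2 * ?B1 u u" by simp
  have "L2_inner \<Omega> u u \<le> CARD('n) * (d + \<delta>)\<^sup>2 * (2 * ?B1 u u)" by (rule Poincare_Korn_X0[OF u])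
  also have "\<dots> \<le> ?P * (2 * ?B1 u u)"
    using \<delta>_max d_nonneg \<delta>_pos B1u by (intro mult_right_mono mult_left_mono power_mono) auto
  finally have "L2_inner \<Omega> u u + 2 * ?B1 u u \<le> (1 + ?P) * (2 * ?B1 u u)" by (simp add: algebra_simps)
  also have "\<dots> = 2 * (1 + ?P) / \<kappa>_min * (\<kappa>_min * ?B1 u u)" using \<kappa>_min by simp
  also have "\<dots> = 2 * (1 + ?P) / \<kappa>_min * B_form \<Omega> (\<lambda>x. \<kappa>_min) k \<delta> u u"
    by (simp only: B_form_const[of \<kappa>_min])
  also have "\<dots> \<le> 2 * (1 + ?P) / \<kappa>_min * B_form \<Omega> \<kappa> k \<delta> u u"
  proof (rule mult_left_mono)
    show "B_form \<Omega> (\<lambda>x. \<kappa>_min) k \<delta> u u \<le> B_form \<Omega> \<kappa> k \<delta> u u"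
      by (rule B_form_mono[OF _ \<kappa>m _ uX, of _ \<kappa>_max]) (use \<kappa> \<kappa>_min in auto)
  qed (use \<kappa>_min in simp)
  also have "2 * (1 + ?P) / \<kappa>_min = (sqrt (2 * (1 + ?P) / \<kappa>_min))\<^sup>2"
    using \<kappa>_min by (subst real_sqrt_pow2) auto
  finally show "L2_inner \<Omega> u u + 2 * ?B1 u u \<le> (sqrt (2 * (1 + ?P) / \<kappa>_min))\<^sup>2 * B_form \<Omega> \<kappa> k \<delta> u u" .
  have "B_form \<Omega> \<kappa> k \<delta> u u \<le> B_form \<Omega> (\<lambda>x. \<kappa>_max) k \<delta> u u"
    by (rule B_form_mono[OF \<kappa>m _ _ uX, of _ \<kappa>_max]) (use \<kappa> \<kappa>_min in force)+
  also have "\<dots> = \<kappa>_max / 2 * (2 * ?B1 u u)" by (simp add: B_form_const[of \<kappa>_max])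
  also have "\<dots> \<le> \<kappa>_max / 2 * (L2_inner \<Omega> u u + 2 * ?B1 u u)"
    using \<open>0 \<le> \<kappa>_max\<close> by (intro mult_left_mono) (auto simp: L2_inner_def)
  finally show "B_form \<Omega> \<kappa> k \<delta> u u \<le> (sqrt (\<kappa>_max / 2))\<^sup>2 * (L2_inner \<Omega> u u + 2 * ?B1 u u)"
    using \<open>0 \<le> \<kappa>_max\<close> by simp
qed (use assms(2,4) in auto)

end

section \<open>Kernel profiles as Borel functions\<close>

text \<open>
  The value of a profile at the origin is arbitrary, and its values at negative numbers have no
  meaning. Only positive arguments matter to the integrands, which vanish on the diagonal because
  division by zero gives zero; on these the profile is Borel by the monotonicity of
  $k(r)/r^2$.
\<close>

definition punctured :: "(real \<Rightarrow> real) \<Rightarrow> real \<Rightarrow> real" where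
  "punctured k r = (if 0 < r then k r else 0)"

lemma punctured_spaces:
  fixes \<Omega> :: "(real^'n::finite) set"
  shows "X0_space \<Omega> (punctured k) \<delta> = X0_space \<Omega> k \<delta>"
    and "X_norm \<Omega> (punctured k) \<delta> = X_norm \<Omega> k \<delta>"
    and "B_form \<Omega> \<kappa> (punctured k) \<delta> = B_form \<Omega> \<kappa> k \<delta>"
proof -
  have X: "X_integrand (punctured k) u = X_integrand k u" for u :: "real^'n \<Rightarrow> real^'n"
    by (auto simp: X_integrand_def punctured_def)
  have B: "B_integrand \<kappa> (punctured k) u v = B_integrand \<kappa> k u v" for u v :: "real^'n \<Rightarrow> real^'n"
    by (auto simp: B_integrand_def punctured_def)
  show "X0_space \<Omega> (punctured k) \<delta> = X0_space \<Omega> k \<delta>"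
    by (simp add: X0_space_def X_space_def X)
  show "X_norm \<Omega> (punctured k) \<delta> = X_norm \<Omega> k \<delta>"
    by (simp add: fun_eq_iff X_norm_def X_seminorm_def X)
  show "B_form \<Omega> \<kappa> (punctured k) \<delta> = B_form \<Omega> \<kappa> k \<delta>"
    by (simp add: fun_eq_iff B_form_eq B)
qed

lemma borel_measurable_punctured:
  assumes "\<And>r s. 0 < r \<Longrightarrow> r \<le> s \<Longrightarrow> k s / s\<^sup>2 \<le> k r / r\<^sup>2"
  shows "punctured k \<in> borel_measurable borel"
proof -
  have "(\<lambda>r. - (k r / r\<^sup>2)) \<in> borel_measurable (restrict_space borel {0<..})"
    using assms by (intro borel_measurable_mono_on_fnc mono_onI) auto
  then have "(\<lambda>r. indicat_real {0<..} r *\<^sub>R (- (k r / r\<^sup>2))) \<in> borel_measurable borel"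
    by (subst (asm) borel_measurable_restrict_space_iff) auto
  then have "(\<lambda>r. - (r\<^sup>2 * (indicat_real {0<..} r *\<^sub>R (- (k r / r\<^sup>2))))) \<in> borel_measurable borel"
    by measurable
  also have "(\<lambda>r. - (r\<^sup>2 * (indicat_real {0<..} r *\<^sub>R (- (k r / r\<^sup>2))))) = punctured k"
    by (auto simp: punctured_def)
  finally show ?thesis .
qed

lemma nonlocal_kernel_punctured:
  fixes \<Omega> :: "(real^'n::finite) set"
  assumes "open \<Omega>" "kernel_family TYPE('n) k" "0 < \<delta>" "0 \<le> d"
    and "\<And>x y. x \<in> \<Omega> \<Longrightarrow> y \<in> \<Omega> \<Longrightarrow> norm (x - y) \<le> d"
  shows "nonlocal_kernel \<Omega> (punctured (k \<delta>)) \<delta> d"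
proof
  have k: "\<And>r. 0 \<le> r \<Longrightarrow> 0 \<le> k \<delta> r" "integrable lebesgue (\<lambda>\<xi>::real^'n. k \<delta> (norm \<xi>))"
    "\<And>\<xi>::real^'n. \<xi> \<notin> ball 0 \<delta> \<Longrightarrow> k \<delta> (norm \<xi>) = 0"
    "(LINT \<xi>::real^'n|lebesgue. k \<delta> (norm \<xi>)) = 1"
    "\<And>r s. 0 < r \<Longrightarrow> r \<le> s \<Longrightarrow> k \<delta> s / s\<^sup>2 \<le> k \<delta> r / r\<^sup>2"
    using assms(2,3) unfolding kernel_family_def by blast+
  show "punctured (k \<delta>) \<in> borel_measurable borel"
    by (rule borel_measurable_punctured) (rule k(5))
  show "0 \<le> punctured (k \<delta>) r" for r using k(1)[of r] by (simp add: punctured_def)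
  show "punctured (k \<delta>) r = 0" if "\<delta> \<le> r" for r
  proof -
    have "0 \<le> r" using that assms(3) by linarith
    then obtain \<xi> :: "real^'n" where "norm \<xi> = r" by (rule vector_choose_size)
    then show ?thesis using k(3)[of \<xi>] that by (simp add: punctured_def)
  qed
  have "(\<integral>\<^sup>+\<xi>. ennreal (punctured (k \<delta>) (norm \<xi>)) \<partial>(lborel :: (real^'n) measure))
      = (\<integral>\<^sup>+\<xi>. ennreal (punctured (k \<delta>) (norm \<xi>)) \<partial>(lebesgue :: (real^'n) measure))"
    by (simp add: nn_integral_completion)
  also have "\<dots> = (\<integral>\<^sup>+\<xi>. ennreal (k \<delta> (norm \<xi>)) \<partial>(lebesgue :: (real^'n) measure))"
  proof (rule nn_integral_cong_AE)
    have "AE \<xi> in lebesgue. \<xi> \<noteq> (0::real^'n)" by (rule AE_completion[OF AE_lborel_singleton])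
    then show "AE \<xi> in lebesgue. ennreal (punctured (k \<delta>) (norm (\<xi>::real^'n))) = ennreal (k \<delta> (norm \<xi>))"
      by eventually_elim (simp add: punctured_def)
  qed
  also have "\<dots> = ennreal (LINT \<xi>::real^'n|lebesgue. k \<delta> (norm \<xi>))"
    by (rule nn_integral_eq_integral[OF k(2)]) (simp add: k(1))
  finally show "(\<integral>\<^sup>+\<xi>. ennreal (punctured (k \<delta>) (norm \<xi>)) \<partial>(lborel :: (real^'n) measure)) = 1"
    by (simp add: k(4))
qed (use assms in auto)

section \<open>Error estimates uniform in the horizon\<close>

theorem theorem6p2:
  fixes \<Omega> :: "(real^'n) set"
    and k :: "real \<Rightarrow> real \<Rightarrow> real"
    and \<kappa> :: "real^'n \<Rightarrow> real"
    and \<kappa>_min \<kappa>_max \<delta>_max lam :: real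
    and a b :: "real^'n \<Rightarrow> real^'n"
    and \<T> :: "real \<Rightarrow> real \<Rightarrow> (real^'n) set set"
  assumes "open \<Omega>" and "bounded \<Omega>" and "lipschitz_boundary \<Omega>"
    and "kernel_family TYPE('n) k"
    and "0 < \<delta>_max"
    and "\<kappa> \<in> borel_measurable (lebesgue_on (Omega_ext \<Omega> \<delta>_max))"
    and "0 < \<kappa>_min"
    and "\<forall>x \<in> Omega_ext \<Omega> \<delta>_max. \<kappa>_min \<le> \<kappa> x \<and> \<kappa> x \<le> \<kappa>_max"
    and "a \<in> Linfty \<Omega>" and "b \<in> Linfty \<Omega>"
    and "(\<lambda>x. 0) \<in> Z_ad \<Omega> a b"
    and "0 < lam"
    and "\<forall>\<delta>>0. quasi_uniform_meshes (Omega_ext \<Omega> \<delta>) (\<T> \<delta>)"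
  shows "\<exists>\<delta>0>0. \<exists>C>0. \<forall>h>0. \<forall>\<delta>. 0 < \<delta> \<and> \<delta> \<le> \<delta>0 \<longrightarrow>
    (\<forall>u g p uh gh ph u_hat p_hat.
       optimal_pair \<Omega> \<kappa> (k \<delta>) \<delta> lam (X0_space \<Omega> (k \<delta>) \<delta>) (Z_ad \<Omega> a b) u g \<longrightarrow>
       p \<in> X0_space \<Omega> (k \<delta>) \<delta> \<longrightarrow>
       (\<forall>v \<in> X0_space \<Omega> (k \<delta>) \<delta>. B_form \<Omega> \<kappa> (k \<delta>) \<delta> v p = L2_inner \<Omega> u v) \<longrightarrow>
       optimal_pair \<Omega> \<kappa> (k \<delta>) \<delta> lam (Xh_space \<Omega> \<delta> (\<T> \<delta> h))
         (Z_ad \<Omega> a b \<inter> Zh_space \<Omega> (\<T> \<delta> h)) uh gh \<longrightarrow>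
       ph \<in> Xh_space \<Omega> \<delta> (\<T> \<delta> h) \<longrightarrow>
       (\<forall>v \<in> Xh_space \<Omega> \<delta> (\<T> \<delta> h). B_form \<Omega> \<kappa> (k \<delta>) \<delta> v ph = L2_inner \<Omega> uh v) \<longrightarrow>
       u_hat \<in> X0_space \<Omega> (k \<delta>) \<delta> \<longrightarrow>
       (\<forall>v \<in> X0_space \<Omega> (k \<delta>) \<delta>. B_form \<Omega> \<kappa> (k \<delta>) \<delta> u_hat v = L2_inner \<Omega> gh v) \<longrightarrow>
       p_hat \<in> X0_space \<Omega> (k \<delta>) \<delta> \<longrightarrow>
       (\<forall>v \<in> X0_space \<Omega> (k \<delta>) \<delta>. B_form \<Omega> \<kappa> (k \<delta>) \<delta> v p_hat = L2_inner \<Omega> v uh) \<longrightarrow>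
       X_norm \<Omega> (k \<delta>) \<delta> (\<lambda>x. u x - uh x)
         \<le> C * ((INF v \<in> Xh_space \<Omega> \<delta> (\<T> \<delta> h). X_norm \<Omega> (k \<delta>) \<delta> (\<lambda>x. u_hat x - v x))
                + L2_norm \<Omega> (\<lambda>x. g x - gh x)) \<and>
       X_norm \<Omega> (k \<delta>) \<delta> (\<lambda>x. p x - ph x)
         \<le> C * ((INF v \<in> Xh_space \<Omega> \<delta> (\<T> \<delta> h). X_norm \<Omega> (k \<delta>) \<delta> (\<lambda>x. p_hat x - v x))
                + (INF v \<in> Xh_space \<Omega> \<delta> (\<T> \<delta> h). X_norm \<Omega> (k \<delta>) \<delta> (\<lambda>x. u_hat x - v x))
                + L2_norm \<Omega> (\<lambda>x. g x - gh x)))"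
proof -
  obtain b0 where b0: "\<And>x. x \<in> \<Omega> \<Longrightarrow> norm x \<le> b0" using \<open>bounded \<Omega>\<close> bounded_iff by blast
  define d where "d = 2 * \<bar>b0\<bar>"
  have d: "0 \<le> d" by (simp add: d_def)
  have diam: "norm (x - y) \<le> d" if "x \<in> \<Omega>" "y \<in> \<Omega>" for x y
    using norm_triangle_ineq4[of x y] b0[OF that(1)] b0[OF that(2)] by (simp add: d_def)
  define m where "m = sqrt (2 * (1 + CARD('n) * (d + \<delta>_max)\<^sup>2) / \<kappa>_min)"
  define M where "M = sqrt (\<bar>\<kappa>_max\<bar> / 2)"
  define A where "A = m * (m + M)"
  have m_pos: "0 < m" using \<open>0 < \<kappa>_min\<close> by (simp add: m_def add_pos_nonneg)
  have A: "0 < A" using m_pos by (simp add: A_def M_def add_pos_nonneg)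
  show ?thesis
  proof (rule exI[of _ \<delta>_max], rule conjI[OF \<open>0 < \<delta>_max\<close>], rule exI[of _ "A + A\<^sup>2"],
      rule conjI, goal_cases)
    case 1
    show ?case using A by (simp add: add_pos_nonneg)
  next
    case 2
    show ?case
    proof (intro allI impI, goal_cases)
      case (1 h \<delta> u g p uh gh ph u_hat p_hat)
      then have h: "0 < h" and \<delta>: "0 < \<delta>" "\<delta> \<le> \<delta>_max" by auto
      \<comment> \<open>All spaces and forms are unchanged when the profile is replaced by its punctured version.\<close>
      let ?k = "punctured (k \<delta>)" and ?\<T> = "\<T> \<delta> h"
      interpret nonlocal_kernel \<Omega> ?k \<delta> d
        using assms(1,4) \<delta>(1) d diam by (rule nonlocal_kernel_punctured)
      have E: "E \<subseteq> Omega_ext \<Omega> \<delta>_max" using \<delta> by (auto simp: Omega_ext_def)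
      have \<kappa>m: "\<kappa> \<in> borel_measurable (lebesgue_on E)"
        using assms(6) E by (rule measurable_restrict_mono)
      have \<kappa>: "\<kappa>_min \<le> \<kappa> x \<and> \<kappa> x \<le> \<bar>\<kappa>_max\<bar>" if "x \<in> E" for x
        using assms(8) E that by (meson abs_ge_self order_trans subsetD)
      have mesh: "mesh E h ?\<T>"
        using assms(13) \<delta>(1) h by (simp add: quasi_uniform_meshes_def)
      have cs: "control_setting (L2 \<Omega>) (X0_space \<Omega> ?k \<delta>) (Xh_space \<Omega> \<delta> ?\<T>) (L2_inner \<Omega>)
        (B_form \<Omega> \<kappa> ?k \<delta>) (\<lambda>u v. L2_inner \<Omega> u v + 2 * B_form \<Omega> (\<lambda>x. 1) ?k \<delta> u v) m M"
        unfolding m_def M_def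
        using \<kappa>m assms(7) \<kappa> abs_ge_zero mesh_elements[OF mesh] \<delta>(2) by (rule control_setting_X0)
      then interpret control_setting "L2 \<Omega>" "X0_space \<Omega> ?k \<delta>" "Xh_space \<Omega> \<delta> ?\<T>" "L2_inner \<Omega>"
        "B_form \<Omega> \<kappa> ?k \<delta>" "\<lambda>u v. L2_inner \<Omega> u v + 2 * B_form \<Omega> (\<lambda>x. 1) ?k \<delta> u v" m M .
      have X_norm: "X_norm \<Omega> (k \<delta>) \<delta> = N.seminorm"
      proof
        show "X_norm \<Omega> (k \<delta>) \<delta> v = N.seminorm v" for v
          using X_norm_eq[of v] by (simp only: N.seminorm_def punctured_spaces(2))
      qed
      have L2_norm: "L2_norm \<Omega> = L.seminorm"
        by (auto simp: L.seminorm_def L2_norm_eq)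
      have u: "u \<in> X0_space \<Omega> ?k \<delta>" "\<And>v. v \<in> X0_space \<Omega> ?k \<delta> \<Longrightarrow> B_form \<Omega> \<kappa> ?k \<delta> u v = L2_inner \<Omega> g v"
        and g: "g \<in> L2 \<Omega>"
        using 1(3) by (auto simp: optimal_pair_def is_arg_min_def Z_ad_def punctured_spaces)
      have uh: "uh \<in> Xh_space \<Omega> \<delta> ?\<T>"
          "\<And>v. v \<in> Xh_space \<Omega> \<delta> ?\<T> \<Longrightarrow> B_form \<Omega> \<kappa> ?k \<delta> uh v = L2_inner \<Omega> gh v"
        and gh: "gh \<in> L2 \<Omega>"
        using 1(6) by (auto simp: optimal_pair_def is_arg_min_def Z_ad_def punctured_spaces)
      have ne: "Xh_space \<Omega> \<delta> ?\<T> \<noteq> {}" using zero_in_Xh by blast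
      have p: "p \<in> X0_space \<Omega> ?k \<delta>" "\<And>v. v \<in> X0_space \<Omega> ?k \<delta> \<Longrightarrow> B_form \<Omega> \<kappa> ?k \<delta> v p = L2_inner \<Omega> u v"
        and ph: "ph \<in> Xh_space \<Omega> \<delta> ?\<T>"
          "\<And>v. v \<in> Xh_space \<Omega> \<delta> ?\<T> \<Longrightarrow> B_form \<Omega> \<kappa> ?k \<delta> v ph = L2_inner \<Omega> uh v"
        and u_hat: "u_hat \<in> X0_space \<Omega> ?k \<delta>"
          "\<And>v. v \<in> X0_space \<Omega> ?k \<delta> \<Longrightarrow> B_form \<Omega> \<kappa> ?k \<delta> u_hat v = L2_inner \<Omega> gh v"
        and p_hat: "p_hat \<in> X0_space \<Omega> ?k \<delta>"
          "\<And>v. v \<in> X0_space \<Omega> ?k \<delta> \<Longrightarrow> B_form \<Omega> \<kappa> ?k \<delta> v p_hat = L2_inner \<Omega> v uh"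
        using 1(4,5,7-12) by (simp_all add: punctured_spaces)
      show ?case
        unfolding X_norm L2_norm
        using state_and_adjoint_error[OF m_pos ne u p uh ph u_hat p_hat g gh] by (simp add: A_def)
    qed
  qed
qed

end
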